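(* Let $m\ge3$ be odd and $N=2^{m+1}$. The graph $\Gamma_m$ is distance regular on $N^2$ vertices, with diameter 4 and degree $N$.
   Context: Let $n=2^m-1$, $h_2(X)\in\mathbb Z_2[X]$ primitive irreducible of degree $m$, $h(X)\in\mathbb Z_4[X]$ the unique monic degree-$m$ polynomial with $h\equiv h_2\pmod 2$ and $h\mid X^n-1$ in $\mathbb Z_4[X]$. $\mathcal P\subseteq\mathbb Z_4^{N/2}$ is obtained from the cyclic code of length $n$ over $\mathbb Z_4$ generated by $h(X)$ by adjoining a zero-sum check coordinate $c_\infty=-\sum c_t$. Gray map: $\beta(0,1,2,3)=(0,0,1,1)$, $\gamma(0,1,2,3)=(0,1,1,0)$ componentwise, $\phi(c)=(\beta(c),\gamma(c))$. A $\mathbb Z_4$-coset of $P=\phi(\mathcal P)$ is the image under $\phi$ of a coset $x+\mathcal P$ of $\mathcal P$ in $\mathbb Z_4^{N/2}$. $\Gamma_m$ is the graph whose vertices are the $\mathbb Z_4$-cosets of $P$, two being adjacent when they are images of cosets $x+\mathcal P$, $y+\mathcal P$ such that $x-y+\mathcal P$ has minimal Lee weight 1 (Lee weights of $0,1,2,3$ are $0,1,2,1$, summed over coordinates). *)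

theory Defs
  imports
    "HOL-Library.Numeral_Type"
    "HOL-Library.Z2"
    "HOL-Computational_Algebra.Polynomial"
    "HOL-Computational_Algebra.Factorial_Ring"
    "Jordan_Normal_Form.Matrix"
    "Graph_Theory.Pair_Digraph"
    "Graph_Theory.Digraph_Component"
    "Graph_Theory.Shortest_Path"
begin

text \<open>
  \<open>\<int>\<^sub>2\<close> is the field \<^typ>\<open>bit\<close>, and \<open>\<int>\<^sub>4\<close> is the ring \<^typ>\<open>4\<close> of integers modulo 4.
\<close>

text \<open>
  The residue class of \<open>X\<close> is the canonical root of \<open>h\<close> in the field \<open>\<int>\<^sub>2[X]/(h)\<close>. It is a primitive
  element iff its powers are exactly the nonzero elements. (Writing \<open>\<longleftrightarrow>\<close> rather than \<open>\<longrightarrow>\<close> excludes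
  \<open>h = X\<close>.)
\<close>
definition primitive_irreducible :: "bit poly \<Rightarrow> bool" where
  "primitive_irreducible h \<longleftrightarrow>
     irreducible h \<and> (\<forall>f. \<not> h dvd f \<longleftrightarrow> (\<exists>k. h dvd f - monom 1 k))"

definition reduce2 :: "4 \<Rightarrow> bit" where
  "reduce2 a = of_int (Rep_bit0 a)"

definition poly_of_vec4 :: "4 vec \<Rightarrow> 4 poly" where
  "poly_of_vec4 c = (\<Sum>t<dim_vec c. monom (c $ t) t)"

text \<open>The ideal generated by \<open>h\<close> in \<open>\<int>\<^sub>4[X]/(X\<^sup>n - 1)\<close>, as a set of words of length \<open>n\<close>.\<close>
definition cyclic_code :: "nat \<Rightarrow> 4 poly \<Rightarrow> 4 vec set" where
  "cyclic_code n h =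
     {c \<in> carrier_vec n. \<exists>a. (monom 1 n - 1) dvd (poly_of_vec4 c - a * h)}"

text \<open>The check coordinate \<open>c\<^sub>\<infinity>\<close> is put in front, at index \<open>0\<close>; \<open>c\<^sub>t\<close> sits at index \<open>t + 1\<close>.\<close>
definition extend_code :: "4 vec set \<Rightarrow> 4 vec set" where
  "extend_code C = (\<lambda>c. vCons (- (\<Sum>t<dim_vec c. c $ t)) c) ` C"

definition preparata4 :: "nat \<Rightarrow> 4 poly \<Rightarrow> 4 vec set" where
  "preparata4 m h = extend_code (cyclic_code (2 ^ m - 1) h)"

definition lee :: "4 \<Rightarrow> nat" where
  "lee a = (if a = 0 then 0 else if a = 2 then 2 else 1)"

definition lee_weight :: "4 vec \<Rightarrow> nat" where
  "lee_weight v = (\<Sum>i<dim_vec v. lee (v $ i))"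

definition min_lee_weight :: "4 vec set \<Rightarrow> nat" where
  "min_lee_weight S = (INF v\<in>S. lee_weight v)"

definition gray_beta :: "4 \<Rightarrow> bit" where
  "gray_beta a = (if a = 2 \<or> a = 3 then 1 else 0)"

definition gray_gamma :: "4 \<Rightarrow> bit" where
  "gray_gamma a = (if a = 1 \<or> a = 2 then 1 else 0)"

definition gray :: "4 vec \<Rightarrow> bit vec" where
  "gray c = map_vec gray_beta c @\<^sub>v map_vec gray_gamma c"

definition coset :: "4 vec set \<Rightarrow> 4 vec \<Rightarrow> 4 vec set" where
  "coset C x = (\<lambda>c. x + c) ` C"

text \<open>For a code \<open>C\<close> of length \<open>l\<close> over \<open>\<int>\<^sub>4\<close>. An undirected edge is a pair of opposite arcs.\<close>
definition coset_graph :: "nat \<Rightarrow> 4 vec set \<Rightarrow> bit vec set pair_pre_digraph" where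
  "coset_graph l C =
     \<lparr> pverts = {gray ` coset C x | x. x \<in> carrier_vec l},
       parcs = {(gray ` coset C x, gray ` coset C y) | x y.
                  x \<in> carrier_vec l \<and> y \<in> carrier_vec l \<and>
                  min_lee_weight (coset C (x - y)) = 1} \<rparr>"

definition Gamma_graph :: "nat \<Rightarrow> 4 poly \<Rightarrow> bit vec set pair_pre_digraph" where
  "Gamma_graph m h = coset_graph (2 ^ m) (preparata4 m h)"

text \<open>The length of a shortest path (\<open>\<infinity>\<close> if there is none).\<close>
definition graph_dist :: "'a pair_pre_digraph \<Rightarrow> 'a \<Rightarrow> 'a \<Rightarrow> ereal" where
  "graph_dist G u v = wf_digraph.\<mu> (with_proj G) (\<lambda>_. 1) u v"

definition graph_diameter :: "'a pair_pre_digraph \<Rightarrow> ereal" where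
  "graph_diameter G = (SUP (u, v) \<in> pverts G \<times> pverts G. graph_dist G u v)"

text \<open>
  \<^locale>\<open>pair_graph\<close> says that the graph is finite, undirected and loopless. The numbers \<open>b i\<close>, \<open>c i\<close>
  are the intersection numbers: for \<open>u\<close>, \<open>v\<close> at distance \<open>i\<close>, the vertex \<open>v\<close> has \<open>c i\<close> neighbours at
  distance \<open>i - 1\<close> from \<open>u\<close> and \<open>b i\<close> neighbours at distance \<open>i + 1\<close> from \<open>u\<close>. The distance \<open>i - 1\<close> is
  written additively, so that there is no such neighbour for \<open>i = 0\<close>.
\<close>
definition distance_regular :: "'a pair_pre_digraph \<Rightarrow> bool" where
  "distance_regular G \<longleftrightarrow>
     pair_graph G \<and> connected (with_proj G) \<and>
     (\<exists>b c :: nat \<Rightarrow> nat. \<forall>u\<in>pverts G. \<forall>v\<in>pverts G. \<forall>i. graph_dist G u v = ereal (real i) \<longrightarrow>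
        card {w. (v, w) \<in> parcs G \<and> graph_dist G u w + 1 = ereal (real i)} = c i \<and>
        card {w. (v, w) \<in> parcs G \<and> graph_dist G u w = ereal (real i) + 1} = b i)"

end

theory Submission
  imports Defs "HOL-Library.Product_Plus" "HOL-Computational_Algebra.Polynomial_Factorial"
begin

text \<open>
  Let \<open>R = \<int>\<^sub>4[X]/(h)\<close> and let \<open>T = {0, 1, \<xi>, \<dots>, \<xi>\<^bsup>n-1\<^esup>}\<close> with \<open>\<xi>\<close> the class of \<open>X\<close>. The
  syndrome \<open>x \<mapsto> (\<Sum> x\<^sub>i, \<Sum> x\<^sub>i t\<^sub>i)\<close>, where \<open>t\<^sub>i\<close> runs through \<open>T\<close>, identifies \<open>\<Gamma>\<^sub>m\<close> with the Cayley graph of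
  \<open>\<int>\<^sub>4 \<times> R\<close> for the generators \<open>S = {\<plusminus>(1, t) | t \<in> T}\<close>. This graph is bipartite by the parity of the
  first coordinate. The nonzero elements of \<open>K = {0} \<times> 2R\<close> have distance 4 from \<open>0\<close>, all other
  nonzero even elements distance 2, and the odd elements outside \<open>S\<close> distance 3.

  Every odd element is congruent modulo \<open>K\<close> to exactly one generator, because \<open>T\<close>
  represents \<open>R/2R\<close>. Every even element outside \<open>K\<close> is a sum of two generators in exactly two ordered
  ways: at most two, and then exactly two by double counting. For the upper bound, write
  \<open>t\<^sub>i = a\<^sup>2\<close>, \<open>t\<^sub>j = b\<^sup>2\<close>, \<open>t\<^sub>k = c\<^sup>2\<close>, \<open>t\<^sub>l = d\<^sup>2\<close> and use that a square in \<open>R\<close> depends only on its root modulo 2. If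
  \<open>t\<^sub>i + t\<^sub>j = t\<^sub>k + t\<^sub>l\<close>, then \<open>a + b = c + d\<close> modulo 2, hence \<open>(a + b)\<^sup>2 = (c + d)\<^sup>2\<close> and \<open>2ab = 2cd\<close>, so
  \<open>{a, b} = {c, d}\<close> modulo 2. If \<open>t\<^sub>i + t\<^sub>j + t\<^sub>k + t\<^sub>l = 0\<close>, then in the same way the first two elementary
  symmetric functions of \<open>a, b, c, d\<close> vanish modulo 2, so \<open>u\<^sup>2 + u v + v\<^sup>2 = 0\<close> for \<open>u = a + b\<close>,
  \<open>v = a + c\<close>. As \<open>m\<close> is odd, this forces \<open>u = v = 0\<close>, and all four elements coincide.
\<close>


section \<open>Distance-regular Cayley graphs\<close>

lemma (in pair_wf_digraph) awalk_level_bound: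
  assumes "awalk u p v" and "\<And>v w. (v, w) \<in> parcs G \<Longrightarrow> d w \<le> Suc (d v)"
  shows "d v \<le> length p + d u"
  using assms(1)
proof (induction p arbitrary: u)
  case Nil
  then show ?case by (simp add: awalk_Nil_iff)
next
  case (Cons e p)
  then have e: "e \<in> parcs G" "fst e = u" and "awalk (snd e) p v"
    by (auto simp: awalk_Cons_iff)
  then have "d v \<le> length p + d (snd e)" using Cons.IH by blast
  moreover have "d (snd e) \<le> Suc (d u)"
    using assms(2)[of u "snd e"] e by (metis prod.collapse)
  ultimately show ?case by simp
qed

lemma (in pair_wf_digraph) awalk_level_exists:
  assumes "u \<in> pverts G" and "v \<in> pverts G"
    and "\<And>v. v \<in> pverts G \<Longrightarrow> d v = 0 \<Longrightarrow> v = u"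
    and "\<And>v. v \<in> pverts G \<Longrightarrow> d v \<noteq> 0 \<Longrightarrow> \<exists>w. (w, v) \<in> parcs G \<and> Suc (d w) = d v"
  shows "\<exists>p. awalk u p v \<and> length p = d v"
  using assms(2)
proof (induction "d v" arbitrary: v)
  case 0
  then have "v = u" using assms(3) by simp
  then show ?case using 0 assms(1) by (auto intro!: exI[of _ "[]"] simp: awalk_Nil_iff)
next
  case (Suc k)
  then obtain w where w: "(w, v) \<in> parcs G" "Suc (d w) = d v" using assms(4)[of v] by auto
  then obtain p where p: "awalk u p w" "length p = d w"
    using Suc.hyps(1)[of w] Suc.hyps(2) in_arcsD1 by auto
  have "awalk w [(w, v)] v"
    using w Suc.prems by (auto simp: awalk_Cons_iff awalk_Nil_iff in_arcsD1)
  with p(1) have "awalk u (p @ [(w, v)]) v" by (rule awalk_appendI)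
  then show ?case using w p by (auto intro!: exI[of _ "p @ [(w, v)]"])
qed

text \<open>Each arc raises \<open>d\<close> by at most one, so a walk from \<open>u\<close> to
  \<open>v\<close> has at least \<open>d v\<close> arcs; following predecessors of smaller level
  back to \<open>u\<close> gives a walk with exactly \<open>d v\<close> arcs.\<close>

lemma graph_dist_level:
  assumes "pair_wf_digraph G" and "u \<in> pverts G" and "v \<in> pverts G" and "d u = 0"
    and "\<And>v w. (v, w) \<in> parcs G \<Longrightarrow> d w \<le> Suc (d v)"
    and "\<And>v. v \<in> pverts G \<Longrightarrow> d v = 0 \<Longrightarrow> v = u"
    and "\<And>v. v \<in> pverts G \<Longrightarrow> d v \<noteq> 0 \<Longrightarrow> \<exists>w. (w, v) \<in> parcs G \<and> Suc (d w) = d v"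
  shows "graph_dist G u v = ereal (real (d v))"
proof -
  interpret pair_wf_digraph G by fact
  have cost: "awalk_cost (\<lambda>_. 1) p = real (length p)" for p :: "('a \<times> 'a) list"
    by (induction p) auto
  obtain p where p: "awalk u p v" "length p = d v"
    using awalk_level_exists[OF assms(2,3), of d] assms(6,7) by blast
  have "d v \<le> length q" if "awalk u q v" for q
    using awalk_level_bound[OF that, of d] assms(4,5) by simp
  then have "(INF q\<in>{q. awalk u q v}. ereal (awalk_cost (\<lambda>_. 1) q)) = ereal (real (d v))"
    using p by (intro antisym INF_greatest) (auto simp: cost intro: INF_lower2)
  then show ?thesis by (simp add: graph_dist_def \<mu>_def)
qed

text \<open>Allows intersection numbers to be computed with natural-number levels. Connectedness
  follows because an unreachable vertex would be at infinite distance.\<close>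

lemma distance_regular_level:
  assumes "pair_graph G" and "pverts G \<noteq> {}"
    and dist: "\<And>u v. u \<in> pverts G \<Longrightarrow> v \<in> pverts G \<Longrightarrow> graph_dist G u v = ereal (real (d u v))"
    and c: "\<And>u v. u \<in> pverts G \<Longrightarrow> v \<in> pverts G \<Longrightarrow>
      card {w. (v, w) \<in> parcs G \<and> Suc (d u w) = d u v} = c (d u v)"
    and b: "\<And>u v. u \<in> pverts G \<Longrightarrow> v \<in> pverts G \<Longrightarrow>
      card {w. (v, w) \<in> parcs G \<and> d u w = Suc (d u v)} = b (d u v)"
  shows "distance_regular G"
proof -
  interpret pair_graph G by fact
  have "u \<rightarrow>\<^sup>*\<^bsub>with_proj G\<^esub> v" if "u \<in> pverts G" "v \<in> pverts G" for u v
  proof (rule ccontr)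
    assume "\<not> u \<rightarrow>\<^sup>*\<^bsub>with_proj G\<^esub> v"
    then have "graph_dist G u v = \<infinity>" by (simp add: graph_dist_def shortest_path_inf)
    with dist[OF that] show False by simp
  qed
  then have "connected (with_proj G)"
    using assms(2) reachable_mk_symmetricI
    by (simp add: connected_def strongly_connected_def)
  moreover have "(v, w) \<in> parcs G \<and> graph_dist G u w + 1 = ereal (real (d u v))
        \<longleftrightarrow> (v, w) \<in> parcs G \<and> Suc (d u w) = d u v"
      "(v, w) \<in> parcs G \<and> graph_dist G u w = ereal (real (d u v)) + 1
        \<longleftrightarrow> (v, w) \<in> parcs G \<and> d u w = Suc (d u v)"
    if "u \<in> pverts G" for u v w
    using dist[OF that, of w] in_arcsD2[of v w] by (auto simp: one_ereal_def)
  ultimately show ?thesis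
    unfolding distance_regular_def using assms(1) dist c b
    by (intro conjI exI[of _ b] exI[of _ c]) auto
qed

text \<open>\<open>A\<close> is the group, \<open>S\<close> the connection set, \<open>E\<close> the
  even elements, and \<open>K\<close> the elements that turn out to be at distance 0 or 4 from 0.
  \<open>flip\<close> makes the Cayley graph bipartite; \<open>count_S\<close> and
  \<open>count_K\<close> supply the intersection numbers c_2 = 2 and b_3 = 1.\<close>

locale cayley_levels =
  fixes A S E K :: "'a::ab_group_add set"
  assumes finite_A: "finite A" and zero_A: "0 \<in> A"
    and diff_A: "\<And>x y. x \<in> A \<Longrightarrow> y \<in> A \<Longrightarrow> x - y \<in> A"
    and S_A: "S \<subseteq> A" and card_S: "card S \<ge> 2" and S_minus: "\<And>s. s \<in> S \<Longrightarrow> - s \<in> S"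
    and K_E: "K \<subseteq> E" and zero_K: "0 \<in> K" and K_nontrivial: "\<exists>x\<in>A \<inter> K. x \<noteq> 0"
    and S_E: "S \<inter> E = {}"
    and flip: "\<And>x s. x \<in> A \<Longrightarrow> s \<in> S \<Longrightarrow> x + s \<in> E \<longleftrightarrow> x \<notin> E"
    and sum_K: "\<And>s t. s \<in> S \<Longrightarrow> t \<in> S \<Longrightarrow> s + t \<in> K \<Longrightarrow> s + t = 0"
    and count_S: "\<And>x. x \<in> A \<inter> E - K \<Longrightarrow> card {s \<in> S. x + s \<in> S} = 2"
    and count_K: "\<And>x. x \<in> A - E \<Longrightarrow> card {s \<in> S. x + s \<in> K} = 1"
begin

text \<open>The prospective distance from 0. The order of the tests matters: 0 lies in
  \<open>K\<close>, and \<open>S\<close> lies outside \<open>E\<close>.\<close>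

definition level :: "'a \<Rightarrow> nat" where
  "level x = (if x = 0 then 0 else if x \<in> S then 1 else if x \<notin> E then 3 else if x \<in> K then 4 else 2)"

text \<open>The intersection numbers b_0, ..., b_4; \<open>down\<close> lists c_0, ..., c_4. They
  add up to \<open>card S\<close> at each index, as no edge stays inside a level.\<close>

definition up :: "nat \<Rightarrow> nat" where
  "up i = [card S, card S - 1, card S - 2, 1, 0] ! i"

definition down :: "nat \<Rightarrow> nat" where
  "down i = [0, 1, 2, card S - 1, card S] ! i"

lemma finite_S: "finite S"
  using finite_A S_A finite_subset by blast

lemma minus_A: "x \<in> A \<Longrightarrow> - x \<in> A"
  using diff_A[OF zero_A] by simp

lemma add_A: "x \<in> A \<Longrightarrow> y \<in> A \<Longrightarrow> x + y \<in> A"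
  using diff_A[OF _ minus_A] by simp

lemma zero_not_S: "0 \<notin> S"
  using S_E K_E zero_K by auto

lemma level_le: "level x \<le> 4"
  by (simp add: level_def)

lemma level_eq_0_iff: "level x = 0 \<longleftrightarrow> x = 0"
  by (simp add: level_def)

lemma card_S_remove:
  assumes "T \<subseteq> S" "card T = k"
  shows "card {s \<in> S. s \<notin> T} = card S - k"
  using assms card_Diff_subset[of T S] finite_subset[OF _ finite_S]
  by (simp add: set_diff_eq)

text \<open>The five cases are the five levels. Parity changes along an edge by \<open>flip\<close>,
  and \<open>sum_K\<close> excludes an edge between \<open>S\<close> and a nonzero element of
  \<open>K\<close>. At most two candidate levels remain, told apart by whether \<open>x + s\<close>
  is 0, in \<open>S\<close> or in \<open>K\<close>.\<close>

lemma neighbour_levels: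
  assumes x: "x \<in> A"
  shows "card {s \<in> S. Suc (level (x + s)) = level x} = down (level x) \<and>
    card {s \<in> S. level (x + s) = Suc (level x)} = up (level x) \<and>
    (\<forall>s\<in>S. Suc (level (x + s)) = level x \<or> level (x + s) = Suc (level x))"
proof -
  consider "x = 0" | "x \<noteq> 0" "x \<in> S" | "x \<in> E" "x \<notin> K" | "x \<notin> S" "x \<notin> E" | "x \<noteq> 0" "x \<in> K"
    by blast
  then show ?thesis
  proof cases
    case 1
    then have "level (x + s) = 1" if "s \<in> S" for s
      using that zero_not_S by (auto simp: level_def)
    moreover have "level x = 0" using 1 by (simp add: level_def)
    ultimately show ?thesis by (simp add: up_def down_def cong: conj_cong)
  next
    case 2
    then have l: "level x = 1" by (simp add: level_def)
    have "level (x + s) = (if s = - x then 0 else 2)" if "s \<in> S" for s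
      using that 2 flip[OF x that] S_E sum_K[of x s]
      by (auto simp: level_def eq_neg_iff_add_eq_0 add.commute)
    then have "{s \<in> S. Suc (level (x + s)) = level x} = {- x}"
      "{s \<in> S. level (x + s) = Suc (level x)} = {s \<in> S. s \<notin> {- x}}"
      "\<forall>s\<in>S. Suc (level (x + s)) = level x \<or> level (x + s) = Suc (level x)"
      using l S_minus[OF 2(2)] by (auto simp: level_eq_0_iff[THEN iffD2] split: if_splits)
    then show ?thesis
      using l card_S_remove[of "{- x}" 1] S_minus[OF 2(2)] by (simp add: up_def down_def)
  next
    case 3
    then have l: "level x = 2" using S_E zero_K by (auto simp: level_def)
    have "level (x + s) = (if x + s \<in> S then 1 else 3)" if "s \<in> S" for s
      using that 3 flip[OF x that] S_E zero_K K_E zero_not_S by (auto simp: level_def)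
    then have "{s \<in> S. Suc (level (x + s)) = level x} = {s \<in> S. x + s \<in> S}"
      "{s \<in> S. level (x + s) = Suc (level x)} = {s \<in> S. s \<notin> {s \<in> S. x + s \<in> S}}"
      "\<forall>s\<in>S. Suc (level (x + s)) = level x \<or> level (x + s) = Suc (level x)"
      using l by (auto split: if_splits)
    then show ?thesis
      using l card_S_remove[of "{s \<in> S. x + s \<in> S}" 2] count_S[of x] x 3
      by (simp add: up_def down_def)
  next
    case 4
    then have l: "level x = 3" using K_E zero_K by (auto simp: level_def)
    have "level (x + s) = (if x + s \<in> K then 4 else 2)" if "s \<in> S" for s
    proof -
      have "x + s \<noteq> 0" using 4(1) S_minus[OF that] by (auto simp: add_eq_0_iff2)
      then show ?thesis using that 4 flip[OF x that] S_E by (auto simp: level_def)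
    qed
    then have "{s \<in> S. level (x + s) = Suc (level x)} = {s \<in> S. x + s \<in> K}"
      "{s \<in> S. Suc (level (x + s)) = level x} = {s \<in> S. s \<notin> {s \<in> S. x + s \<in> K}}"
      "\<forall>s\<in>S. Suc (level (x + s)) = level x \<or> level (x + s) = Suc (level x)"
      using l by (auto split: if_splits)
    then show ?thesis
      using l card_S_remove[of "{s \<in> S. x + s \<in> K}" 1] count_K[of x] x 4
      by (simp add: up_def down_def)
  next
    case 5
    then have l: "level x = 4" using K_E S_E by (auto simp: level_def)
    have "level (x + s) = 3" if "s \<in> S" for s
    proof -
      have "x + s \<notin> S"
        using sum_K[of "x + s" "- s"] S_minus[OF that] 5 by auto
      then show ?thesis using that 5 K_E zero_K flip[OF x that] by (auto simp: level_def)
    qed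
    then show ?thesis using l by (simp add: up_def down_def cong: conj_cong)
  qed
qed


lemma descend:
  assumes "x \<in> A" "level x \<noteq> 0"
  shows "\<exists>s\<in>S. Suc (level (x + s)) = level x"
proof -
  have "level x \<in> {1, 2, 3, 4}" using level_le[of x] assms(2) by auto
  then have "down (level x) \<noteq> 0" using card_S by (auto simp: down_def)
  then have "{s \<in> S. Suc (level (x + s)) = level x} \<noteq> {}"
    using neighbour_levels[OF assms(1)] by (metis card.empty)
  then show ?thesis by blast
qed

text \<open>By translation the distance from \<open>f x\<close> to \<open>f y\<close> is the level
  of \<open>y - x\<close>. The labelling \<open>f\<close> is there because the vertices of the coset
  graph are sets of binary words rather than group elements.\<close>

lemma cayley_graph_distance_regular:
  fixes G :: "'b pair_pre_digraph"
  assumes inj: "inj_on f A" and V: "pverts G = f ` A"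
    and arcs: "parcs G = {(f x, f y) | x y. x \<in> A \<and> y \<in> A \<and> x - y \<in> S}"
  shows "distance_regular G \<and> graph_diameter G = 4 \<and>
    (\<forall>v\<in>pverts G. out_degree (with_proj G) v = card S)"
proof -
  define d where "d u v = level (the_inv_into A f v - the_inv_into A f u)" for u v
  have d_f: "d (f x) (f y) = level (y - x)" if "x \<in> A" "y \<in> A" for x y
    using that inj by (simp add: d_def the_inv_into_f_f)
  have arc_iff: "(f x, w) \<in> parcs G \<longleftrightarrow> (\<exists>s\<in>S. w = f (x + s))" if x: "x \<in> A" for x w
  proof
    assume "(f x, w) \<in> parcs G"
    then obtain y where y: "y \<in> A" "w = f y" "x - y \<in> S"
      using arcs x inj by (auto dest: inj_onD)
    then show "\<exists>s\<in>S. w = f (x + s)" using S_minus[of "x - y"] by (intro bexI[of _ "y - x"]) auto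
  next
    assume "\<exists>s\<in>S. w = f (x + s)"
    then obtain s where s: "s \<in> S" "w = f (x + s)" by blast
    then have "x + s \<in> A" "x - (x + s) \<in> S" using x add_A S_A S_minus by auto
    then show "(f x, w) \<in> parcs G" unfolding arcs using x s by blast
  qed
  have card_nb: "card {w. (f x, w) \<in> parcs G \<and> P w} = card {s \<in> S. P (f (x + s))}"
    if x: "x \<in> A" for x P
  proof -
    have "{w. (f x, w) \<in> parcs G \<and> P w} = (\<lambda>s. f (x + s)) ` {s \<in> S. P (f (x + s))}"
      using arc_iff[OF x] by auto
    moreover have "inj_on (\<lambda>s. f (x + s)) {s \<in> S. P (f (x + s))}"
    proof (rule inj_onI)
      fix s s' assume "s \<in> {s \<in> S. P (f (x + s))}" "s' \<in> {s \<in> S. P (f (x + s))}"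
        and eq: "f (x + s) = f (x + s')"
      then have "x + s \<in> A" "x + s' \<in> A" using x add_A S_A by auto
      with inj eq have "x + s = x + s'" by (rule inj_onD)
      then show "s = s'" by simp
    qed
    ultimately show ?thesis by (simp add: card_image)
  qed
  have sym: "(v, u) \<in> parcs G" if uv: "(u, v) \<in> parcs G" for u v
  proof -
    obtain x y where "u = f x" "v = f y" "x \<in> A" "y \<in> A" "x - y \<in> S" using uv unfolding arcs by auto
    then show ?thesis using S_minus[of "x - y"] arcs by auto
  qed
  have wf: "u \<in> pverts G" "v \<in> pverts G" if "(u, v) \<in> parcs G" for u v
    using that unfolding arcs V by auto
  have "finite (parcs G)"
    by (rule finite_subset[of _ "f ` A \<times> f ` A"]) (use finite_A in \<open>auto simp: arcs\<close>)
  moreover have "fst e \<noteq> snd e" if "e \<in> parcs G" for e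
    using that zero_not_S inj_on_eq_iff[OF inj] unfolding arcs by fastforce
  moreover have "symmetric (with_proj G)"
    using sym by (auto simp: symmetric_def intro!: symI)
  ultimately have graph: "pair_graph G"
    using wf finite_A V by unfold_locales auto
  then interpret G: pair_graph G .
  have dist: "graph_dist G u v = ereal (real (d u v))" if uv: "u \<in> pverts G" "v \<in> pverts G" for u v
  proof (rule graph_dist_level[where d = "d u"])
    obtain x where x: "x \<in> A" "u = f x" using uv V by auto
    show "d u u = 0" by (simp add: d_def level_eq_0_iff)
    show "d u w \<le> Suc (d u v)" if vw: "(v, w) \<in> parcs G" for v w
    proof -
      obtain y where y: "y \<in> A" "v = f y" using wf[OF vw] V by auto
      obtain s where s: "s \<in> S" "w = f (y + s)" using vw arc_iff y by auto
      \<comment> \<open>Translation by \<open>- x\<close> turns the arc into a step from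
        \<open>y - x\<close> by the generator \<open>s\<close>.\<close>
      have "y + s - x = (y - x) + s" by simp
      then have "Suc (level (y + s - x)) = level (y - x) \<or> level (y + s - x) = Suc (level (y - x))"
        using neighbour_levels[of "y - x"] x y s diff_A by metis
      then show ?thesis using x y s add_A S_A by (auto simp: d_f subset_iff)
    qed
    show "v = u" if "v \<in> pverts G" "d u v = 0" for v
      using that x V by (auto simp: d_f level_eq_0_iff)
    show "\<exists>w. (w, v) \<in> parcs G \<and> Suc (d u w) = d u v" if v: "v \<in> pverts G" "d u v \<noteq> 0" for v
    proof -
      obtain y where y: "y \<in> A" "v = f y" using v V by auto
      obtain s where s: "s \<in> S" "Suc (level (y - x + s)) = level (y - x)"
        using descend[of "y - x"] v x y diff_A by (auto simp: d_f)
      have "level (y + s - x) = level (y - x + s)" by (simp add: algebra_simps)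
      then have "Suc (d u (f (y + s))) = d u v" using s x y add_A S_A by (auto simp: d_f subset_iff)
      then show ?thesis using s y arc_iff sym by blast
    qed
  qed (use that graph in \<open>simp_all add: G.pair_wf_digraph\<close>)
  have "card {w. (v, w) \<in> parcs G \<and> Suc (d u w) = d u v} = down (d u v) \<and>
    card {w. (v, w) \<in> parcs G \<and> d u w = Suc (d u v)} = up (d u v)"
    if uv: "u \<in> pverts G" "v \<in> pverts G" for u v
  proof -
    obtain x y where xy: "x \<in> A" "u = f x" "y \<in> A" "v = f y" using uv V by auto
    have "d u (f (y + s)) = level (y - x + s)" if "s \<in> S" for s
      using that xy d_f[of x "y + s"] add_A S_A by (auto simp: algebra_simps)
    then show ?thesis
      using neighbour_levels[of "y - x"] diff_A xy by (simp add: card_nb d_f cong: conj_cong)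
  qed
  then have "distance_regular G"
    using distance_regular_level[OF graph _ dist] V zero_A by blast
  moreover have "graph_diameter G = 4"
  proof -
    \<comment> \<open>A nonzero element of \<open>K\<close> has level 4, so the bound
      \<open>level_le\<close> is attained.\<close>
    obtain x where x: "x \<in> A" "x \<in> K" "x \<noteq> 0" using K_nontrivial by auto
    then have "graph_dist G (f 0) (f x) = 4"
      using dist[of "f 0" "f x"] V zero_A K_E S_E by (auto simp: d_f level_def)
    then have "4 \<le> graph_diameter G"
      unfolding graph_diameter_def using x V zero_A
      by (intro SUP_upper2[of "(f 0, f x)"]) auto
    moreover have "graph_diameter G \<le> 4"
      unfolding graph_diameter_def
    proof (intro SUP_least, clarify)
      fix u v assume "u \<in> pverts G" "v \<in> pverts G"
      then show "graph_dist G u v \<le> 4"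
        using dist level_le by (simp add: d_def)
    qed
    ultimately show ?thesis by simp
  qed
  moreover have "out_degree (with_proj G) v = card S" if v: "v \<in> pverts G" for v
  proof -
    obtain x where x: "x \<in> A" "v = f x" using v V by auto
    have "out_arcs (with_proj G) v = Pair v ` {w. (v, w) \<in> parcs G \<and> True}"
      by (auto simp: out_arcs_def)
    then show ?thesis using card_nb[OF x(1), of "\<lambda>_. True"] x
      by (simp add: out_degree_def card_image inj_on_def)
  qed
  ultimately show ?thesis by blast
qed

end

section \<open>Coset graphs of codes over \<open>\<int>\<^sub>4\<close>\<close>

lemma Z4_cases: "a \<in> {0, 1, 2, 3}" for a :: 4
proof (cases a)
  case (of_int z)
  then have "z = 0 \<or> z = 1 \<or> z = 2 \<or> z = 3" by auto
  with of_int show ?thesis by auto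
qed

text \<open>The two bits together determine an entry. Hence a coset can be recovered from its binary
  image, and the vertices may be counted as cosets.\<close>

lemma gray_inj: "inj_on gray (carrier_vec l)"
proof (rule inj_onI)
  fix x y :: "4 vec"
  assume x: "x \<in> carrier_vec l" and y: "y \<in> carrier_vec l" and eq: "gray x = gray y"
  have dim: "dim_vec x = l" "dim_vec y = l" using x y by auto
  have gg: "a = b" if "gray_beta a = gray_beta b" "gray_gamma a = gray_gamma b" for a b
    using that Z4_cases[of a] Z4_cases[of b] by (auto simp: gray_beta_def gray_gamma_def)
  show "x = y"
  proof (rule eq_vecI)
    fix i assume "i < dim_vec y"
    then have i: "i < l" using dim by simp
    have "gray x $ i = gray y $ i" "gray x $ (l + i) = gray y $ (l + i)" using eq by auto
    then have "gray_beta (x $ i) = gray_beta (y $ i)" "gray_gamma (x $ i) = gray_gamma (y $ i)"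
      using i dim by (auto simp: gray_def)
    then show "x $ i = y $ i" by (rule gg)
  qed (use dim in simp)
qed

lemma lee_weight_eq_0_iff: "lee_weight v = 0 \<longleftrightarrow> v = 0\<^sub>v (dim_vec v)"
  by (auto simp: lee_weight_def lee_def vec_eq_iff split: if_splits)

lemma min_lee_weight_eq_1_iff:
  assumes "X \<noteq> {}"
  shows "min_lee_weight X = 1 \<longleftrightarrow> (\<forall>v\<in>X. lee_weight v \<noteq> 0) \<and> (\<exists>v\<in>X. lee_weight v = 1)"
proof -
  have "min_lee_weight X \<in> lee_weight ` X"
    unfolding min_lee_weight_def using assms by (intro Inf_nat_def1) auto
  then obtain v where v: "v \<in> X" "min_lee_weight X = lee_weight v" by auto
  have le: "min_lee_weight X \<le> lee_weight v" if "v \<in> X" for v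
    unfolding min_lee_weight_def using that by (intro cINF_lower) auto
  show ?thesis
  proof
    assume "min_lee_weight X = 1"
    then show "(\<forall>v\<in>X. lee_weight v \<noteq> 0) \<and> (\<exists>v\<in>X. lee_weight v = 1)"
      using v le by force
  next
    assume "(\<forall>v\<in>X. lee_weight v \<noteq> 0) \<and> (\<exists>v\<in>X. lee_weight v = 1)"
    then show "min_lee_weight X = 1"
      using v le by (metis One_nat_def le_SucE le_zero_eq)
  qed
qed

text \<open>The cosets of the kernel \<open>C\<close> are the fibres \<open>F a\<close> of the
  syndrome map, and \<open>f\<close> sends \<open>a\<close> to the Gray image of \<open>F a\<close>.
  The zero word lies only in the fibre over 0, so \<open>0 \<notin> S\<close> turns minimal weight 1
  into the mere existence of a word of weight 1 in the fibre.\<close>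

lemma coset_graph_syndrome:
  fixes \<sigma> :: "4 vec \<Rightarrow> 'a::ab_group_add"
  assumes diff: "\<And>x y. x \<in> carrier_vec l \<Longrightarrow> y \<in> carrier_vec l \<Longrightarrow> \<sigma> (x - y) = \<sigma> x - \<sigma> y"
    and C: "C = {x \<in> carrier_vec l. \<sigma> x = 0}"
    and A: "A = \<sigma> ` carrier_vec l" and S: "S = \<sigma> ` {v \<in> carrier_vec l. lee_weight v = 1}"
    and "0 \<notin> S"
  obtains f where "inj_on f A" "pverts (coset_graph l C) = f ` A"
    "parcs (coset_graph l C) = {(f x, f y) | x y. x \<in> A \<and> y \<in> A \<and> x - y \<in> S}"
proof -
  define F where "F a = {x \<in> carrier_vec l. \<sigma> x = a}" for a
  have coset: "coset C x = F (\<sigma> x)" if x: "x \<in> carrier_vec l" for x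
  proof (intro equalityI subsetI)
    fix z assume "z \<in> coset C x"
    then obtain c where c: "z = x + c" "c \<in> carrier_vec l" "\<sigma> c = 0"
      by (auto simp: coset_def C)
    then have "\<sigma> z - \<sigma> x = \<sigma> (x + c - x)" using x by (subst diff) auto
    also have "x + c - x = c" using x c by auto
    finally show "z \<in> F (\<sigma> x)" using c x by (simp add: F_def)
  next
    fix z assume "z \<in> F (\<sigma> x)"
    then have z: "z \<in> carrier_vec l" "\<sigma> z = \<sigma> x" by (auto simp: F_def)
    then have "z - x \<in> C" "z = x + (z - x)" using x diff by (auto simp: C)
    then show "z \<in> coset C x" unfolding coset_def by blast
  qed
  have inj: "inj_on (\<lambda>a. gray ` F a) A"
  proof (rule inj_onI)
    fix a b assume ab: "a \<in> A" "b \<in> A" "gray ` F a = gray ` F b"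
    then have "F a = F b"
      using inj_on_image_eq_iff[OF gray_inj[of l], of "F a" "F b"] by (auto simp: F_def)
    moreover obtain x where "x \<in> F a" using ab(1) by (auto simp: A F_def)
    ultimately show "a = b" by (auto simp: F_def)
  qed
  have \<sigma>0: "\<sigma> (0\<^sub>v l) = 0" using diff[of "0\<^sub>v l" "0\<^sub>v l"] by simp
  have adj: "min_lee_weight (coset C (x - y)) = 1 \<longleftrightarrow> \<sigma> x - \<sigma> y \<in> S"
    if "x \<in> carrier_vec l" "y \<in> carrier_vec l" for x y
  proof -
    let ?F = "F (\<sigma> x - \<sigma> y)"
    have "x - y \<in> ?F" using that diff by (simp add: F_def)
    then have "min_lee_weight ?F = 1 \<longleftrightarrow> (\<forall>v\<in>?F. lee_weight v \<noteq> 0) \<and> (\<exists>v\<in>?F. lee_weight v = 1)"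
      by (intro min_lee_weight_eq_1_iff) blast
    also have "(\<forall>v\<in>?F. lee_weight v \<noteq> 0) \<longleftrightarrow> \<sigma> x - \<sigma> y \<noteq> 0"
    proof -
      have "lee_weight v = 0 \<longleftrightarrow> v = 0\<^sub>v l" if "v \<in> ?F" for v
        using that lee_weight_eq_0_iff[of v] by (auto simp: F_def)
      moreover have "0\<^sub>v l \<in> ?F \<longleftrightarrow> \<sigma> x - \<sigma> y = 0" using \<sigma>0 by (auto simp: F_def)
      ultimately show ?thesis by metis
    qed
    also have "(\<exists>v\<in>?F. lee_weight v = 1) \<longleftrightarrow> \<sigma> x - \<sigma> y \<in> S"
      unfolding S F_def by (auto simp: image_iff)
    finally have "min_lee_weight ?F = 1 \<longleftrightarrow> \<sigma> x - \<sigma> y \<in> S" using \<open>0 \<notin> S\<close> by auto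
    then show ?thesis using that coset[of "x - y"] diff by simp
  qed
  show thesis
  proof (rule that[OF inj])
    show "pverts (coset_graph l C) = (\<lambda>a. gray ` F a) ` A"
    proof -
      have "pverts (coset_graph l C) = (\<lambda>x. gray ` coset C x) ` carrier_vec l"
        by (simp add: coset_graph_def Setcompr_eq_image)
      then show ?thesis using coset by (simp add: A image_image)
    qed
    show "parcs (coset_graph l C)
      = {(gray ` F x, gray ` F y) | x y. x \<in> A \<and> y \<in> A \<and> x - y \<in> S}" (is "?L = ?R")
    proof (intro equalityI subsetI)
      fix e assume "e \<in> ?L"
      then obtain x y where "x \<in> carrier_vec l" "y \<in> carrier_vec l"
        "min_lee_weight (coset C (x - y)) = 1" "e = (gray ` coset C x, gray ` coset C y)"
        unfolding coset_graph_def by auto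
      then show "e \<in> ?R" using adj[of x y] coset unfolding A by blast
    next
      fix e assume "e \<in> ?R"
      then obtain x y where xy: "x \<in> carrier_vec l" "y \<in> carrier_vec l"
        "\<sigma> x - \<sigma> y \<in> S" "e = (gray ` F (\<sigma> x), gray ` F (\<sigma> y))"
        unfolding A by blast
      then have "min_lee_weight (coset C (x - y)) = 1"
        "e = (gray ` coset C x, gray ` coset C y)" using adj coset by auto
      then show "e \<in> ?L" using xy(1,2) unfolding coset_graph_def by auto
    qed
  qed
qed

section \<open>Generators from Teichmueller representatives\<close>

text \<open>Models the additive group of the Galois ring with its Teichmueller set. Congruence of
  \<open>x\<close> and \<open>y\<close> modulo 2 is written \<open>2 * (x - y) = 0\<close>, since
  the annihilator of 2 is the ideal generated by 2.\<close>

locale teichmuller_columns =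
  fixes M :: nat and R :: "'a::comm_ring_1 set" and t :: "nat \<Rightarrow> 'a"
  assumes M: "M \<ge> 2" and finite_R: "finite R" and zero_R: "0 \<in> R"
    and diff_R: "\<And>x y. x \<in> R \<Longrightarrow> y \<in> R \<Longrightarrow> x - y \<in> R"
    and card_R: "card R = M ^ 2" and card_R2: "card {r \<in> R. 2 * r = 0} = M"
    and t_R: "\<And>i. i < M \<Longrightarrow> t i \<in> R"
    and t_reduce: "\<And>r. r \<in> R \<Longrightarrow> \<exists>i<M. 2 * (r - t i) = 0"
    and t_distinct: "\<And>i j. i < M \<Longrightarrow> j < M \<Longrightarrow> 2 * (t i - t j) = 0 \<Longrightarrow> i = j"
    and t_diff: "\<And>i j k l. i < M \<Longrightarrow> j < M \<Longrightarrow> k < M \<Longrightarrow> l < M \<Longrightarrow> t i + t j = t k + t l \<Longrightarrow>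
      i = k \<and> j = l \<or> i = l \<and> j = k"
    and t_sum: "\<And>i j k l. i < M \<Longrightarrow> j < M \<Longrightarrow> k < M \<Longrightarrow> l < M \<Longrightarrow> t i + t j + t k + t l = 0 \<Longrightarrow>
      i = j \<and> i = k \<and> i = l"
begin

definition A :: "(4 \<times> 'a) set" where "A = UNIV \<times> R"
definition S :: "(4 \<times> 'a) set" where
  "S = (\<lambda>i. (1, t i)) ` {..<M} \<union> (\<lambda>i. (- 1, - t i)) ` {..<M}"
definition E :: "(4 \<times> 'a) set" where "E = {0, 2} \<times> R"
definition K :: "(4 \<times> 'a) set" where "K = {0} \<times> {r \<in> R. 2 * r = 0}"

section \<open>Sums of two generators\<close>

lemma minus_R: "x \<in> R \<Longrightarrow> - x \<in> R"
  using diff_R[OF zero_R] by simp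

lemma add_R: "x \<in> R \<Longrightarrow> y \<in> R \<Longrightarrow> x + y \<in> R"
  using diff_R[OF _ minus_R] by simp

lemma t_inj: "i < M \<Longrightarrow> j < M \<Longrightarrow> t i = t j \<longleftrightarrow> i = j"
  using t_distinct[of i j] by auto

lemma S_cases:
  assumes "s \<in> S"
  obtains i where "i < M" "s = (1, t i)" | i where "i < M" "s = (- 1, - t i)"
  using assms by (auto simp: S_def)

lemma S_A: "S \<subseteq> A"
  using t_R minus_R by (auto simp: S_def A_def)

lemma S_minus: "s \<in> S \<Longrightarrow> - s \<in> S"
  by (auto simp: S_def)

lemma card_S: "card S = 2 * M"
proof -
  have "card S = card ((\<lambda>i. (1 :: 4, t i)) ` {..<M}) + card ((\<lambda>i. (- 1 :: 4, - t i)) ` {..<M})"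
    unfolding S_def by (intro card_Un_disjoint) (auto simp: eq_neg_iff_add_eq_0)
  then show ?thesis by (simp add: card_image inj_on_def t_inj)
qed

text \<open>First coordinate 0 forces opposite signs; then the two Teichmueller elements agree
  modulo 2 and are equal.\<close>

lemma sum_in_K:
  assumes "s \<in> S" "u \<in> S" "s + u \<in> K"
  shows "s + u = 0"
  using assms(1,2)
proof (elim S_cases, goal_cases)
  case (2 i j)
  then show ?case using assms(3) t_distinct[of i j] by (auto simp: K_def zero_prod_def)
next
  case (3 i j)
  then show ?case using assms(3) t_distinct[of j i] by (auto simp: K_def zero_prod_def)
qed (use assms(3) in \<open>auto simp: K_def\<close>)

text \<open>An element outside \<open>K\<close> has at most one representation as an unordered sum of two generators,
  except that \<open>(2, 2 t\<^sub>i)\<close> is both \<open>s + s\<close> and \<open>- s - s\<close> for \<open>s = (1, t\<^sub>i)\<close>.\<close>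

lemma sum_unique:
  assumes "s \<in> S" "u \<in> S" "s' \<in> S" "u' \<in> S" "s + u = s' + u'" "s + u \<notin> K"
  shows "s' = s \<or> s' = (if s = u then - s else u)"
proof -
  have K0: "s + u \<noteq> 0" using assms(6) zero_R by (auto simp: K_def zero_prod_def)
  have K0': "s' + u' \<noteq> 0" using K0 assms(5) by simp
  have minus_1: "(- 1 :: 4) = 3" and "(1 :: 4) \<noteq> 3" by auto
  show ?thesis
    using assms(1-4)
  \<comment> \<open>The goals are the sixteen sign patterns, eight of which survive comparison of
    first coordinates, where 2 = -2. Two plus signs against two minus signs give a vanishing sum of
    four elements, hence \<open>t_sum\<close> and the exceptional answer \<open>- s\<close>. The
    others rearrange to \<open>t_diff\<close>, where \<open>K0\<close> discards the trivial solution
    for mixed signs.\<close>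
  proof (elim S_cases, goal_cases)
    case (1 i j k l)
    then show ?case using assms(5) t_diff[of i j k l] by auto
  next
    case (4 i j k l)
    have "t i + t j + t k + t l = (t i + t j) - (- t k - t l)" by (simp add: algebra_simps)
    also have "\<dots> = 0" using 4 assms(5) by simp
    finally have "t i + t j + t k + t l = 0" .
    then show ?case using 4 t_sum[of i j k l] by auto
  next
    case (6 i j k l)
    then have "t i + t l = t k + t j" using assms(5) by (simp add: algebra_simps)
    then show ?case using 6 t_diff[of i l k j] K0 by (auto simp: zero_prod_def)
  next
    case (7 i j k l)
    then have "t i + t k = t l + t j" using assms(5) by (simp add: algebra_simps)
    then show ?case using 7 t_diff[of i k l j] K0 by (auto simp: zero_prod_def)
  next
    case (10 i j k l)
    then have "t j + t l = t k + t i" using assms(5) by (simp add: algebra_simps)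
    then show ?case using 10 t_diff[of j l k i] K0 by (auto simp: zero_prod_def)
  next
    case (11 i j k l)
    then have "t j + t k = t l + t i" using assms(5) by (simp add: algebra_simps)
    then show ?case using 11 t_diff[of j k l i] K0 by (auto simp: zero_prod_def)
  next
    case (13 i j k l)
    have "t i + t j + t k + t l = (t k + t l) - (- t i - t j)" by (simp add: algebra_simps)
    also have "\<dots> = 0" using 13 assms(5) by simp
    finally have "t i + t j + t k + t l = 0" .
    then show ?case using 13 t_sum[of i j k l] by auto
  next
    case (16 i j k l)
    have "t i + t j = - (- t i - t j)" by simp
    also have "\<dots> = - (- t k - t l)" using 16 assms(5) by simp
    finally have "t i + t j = t k + t l" by simp
    then show ?case using 16 t_diff[of i j k l] by auto
  qed (use assms(5) in auto)
qed

text \<open>Every counted \<open>s\<close> writes \<open>x\<close> as the sum of the generators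
  \<open>- s\<close> and \<open>x + s\<close>, so \<open>sum_unique\<close> leaves only one further
  candidate.\<close>

lemma card_sum_le_2:
  assumes "x \<notin> K"
  shows "card {s \<in> S. x + s \<in> S} \<le> 2"
proof (cases "{s \<in> S. x + s \<in> S} = {}")
  case False
  then obtain s where s: "s \<in> S" "x + s \<in> S" by auto
  \<comment> \<open>The negative of the second alternative in \<open>sum_unique\<close>, applied to
    \<open>- s\<close> and \<open>x + s\<close>.\<close>
  define w where "w = (if - s = x + s then - s else - (x + s))"
  have "u \<in> {s, w}" if "u \<in> S" "x + u \<in> S" for u
  proof -
    have "- u = - s \<or> - u = (if - s = x + s then - (- s) else x + s)"
      using assms s that S_minus
      by (intro sum_unique[where u' = "x + u"]) auto
    then show ?thesis unfolding w_def by (auto simp del: minus_add_distrib minus_diff_eq simp: neg_equal_iff_equal minus_equation_iff[of u] split: if_splits)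
  qed
  then have "{s \<in> S. x + s \<in> S} \<subseteq> {s, w}" by auto
  then have "card {s \<in> S. x + s \<in> S} \<le> card {s, w}" by (intro card_mono) auto
  also have "\<dots> \<le> 2" by (simp add: card_insert_if)
  finally show ?thesis .
next
  case True
  then show ?thesis by (metis card.empty zero_le)
qed

lemma finite_A: "finite A"
  using finite_R by (simp add: A_def)

lemma card_E_minus_K: "card (A \<inter> E - K) = 2 * M ^ 2 - M"
proof -
  have "A \<inter> E - K = E - K" by (auto simp: A_def E_def)
  moreover have "K \<subseteq> E" "finite E" using finite_R by (auto simp: K_def E_def)
  moreover have "card E = 2 * M ^ 2" "card K = M"
    using card_R card_R2 by (auto simp: E_def K_def card_cartesian_product)
  ultimately show ?thesis by (simp add: card_Diff_subset finite_subset)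
qed

lemma S_diff_E:
  assumes "s \<in> S" "u \<in> S"
  shows "u - s \<in> E"
  using assms t_R minus_R add_R diff_R by (auto simp: S_def E_def)

text \<open>Summed over the even elements outside \<open>K\<close>, the bound \<open>2\<close> gives exactly \<open>|S|\<^sup>2 - |S|\<close>,
  the number of pairs of distinct generators.\<close>

lemma card_sum_eq_2:
  assumes "x \<in> A \<inter> E - K"
  shows "card {s \<in> S. x + s \<in> S} = 2"
proof -
  let ?X = "A \<inter> E - K"
  have fin: "finite S" "finite ?X" using S_A finite_A finite_subset by auto
  have "(\<Sum>x\<in>?X. card {s \<in> S. x + s \<in> S}) = card (SIGMA x:?X. {s \<in> S. x + s \<in> S})"
    using fin by (simp add: card_SigmaI)
  also have "\<dots> = card (S \<times> S - Id)"
  proof (rule bij_betw_same_card)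
    \<comment> \<open>An ordered pair of distinct generators is encoded by its difference
      \<open>x\<close> and its first member \<open>s\<close>.\<close>
    show "bij_betw (\<lambda>(x, s). (s, x + s)) (SIGMA x:?X. {s \<in> S. x + s \<in> S}) (S \<times> S - Id)"
    proof (rule bij_betw_byWitness[where f' = "\<lambda>(s, u). (u - s, s)"])
      show "(\<lambda>(x, s). (s, x + s)) ` (SIGMA x:?X. {s \<in> S. x + s \<in> S}) \<subseteq> S \<times> S - Id"
        using zero_R by (auto simp: K_def zero_prod_def)
      show "(\<lambda>(s, u). (u - s, s)) ` (S \<times> S - Id) \<subseteq> (SIGMA x:?X. {s \<in> S. x + s \<in> S})"
      proof (rule image_subsetI)
        fix p assume "p \<in> S \<times> S - Id"
        then obtain s u where p: "p = (s, u)" and su: "s \<in> S" "u \<in> S" "u \<noteq> s" by auto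
        then have "u - s \<in> E" "u - s \<notin> K"
          using S_diff_E sum_in_K[of u "- s"] S_minus by auto
        moreover have "E \<subseteq> A" by (auto simp: A_def E_def)
        ultimately show "(case p of (s, u) \<Rightarrow> (u - s, s)) \<in> (SIGMA x:?X. {s \<in> S. x + s \<in> S})"
          using su p by auto
      qed
    qed auto
  qed
  also have "S \<times> S - Id = S \<times> S - (\<lambda>s. (s, s)) ` S" by auto
  also have "card \<dots> = card (S \<times> S) - card ((\<lambda>s. (s, s)) ` S)"
    using fin by (intro card_Diff_subset) auto
  also have "\<dots> = 4 * M ^ 2 - 2 * M"
    by (simp add: card_image inj_on_def card_S card_cartesian_product power2_eq_square)
  also have "\<dots> = (\<Sum>x\<in>?X. 2)"
    by (simp add: card_E_minus_K diff_mult_distrib)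
  finally have "(\<Sum>x\<in>?X. card {s \<in> S. x + s \<in> S}) = (\<Sum>x\<in>?X. 2)" .
  then show ?thesis
    \<comment> \<open>A termwise bound with equal totals is an equality in every term.\<close>
    using sum_mono_inv[of "\<lambda>x. card {s \<in> S. x + s \<in> S}" ?X "\<lambda>_. 2" x] card_sum_le_2 assms fin
    by blast
qed

text \<open>The first coordinate of \<open>x\<close> fixes the sign of the generator;
  \<open>t_reduce\<close> and \<open>t_distinct\<close> then give existence and uniqueness of the
  index.\<close>

lemma card_to_K:
  assumes "x \<in> A - E"
  shows "card {s \<in> S. x + s \<in> K} = 1"
proof -
  obtain a r where x: "x = (a, r)" "r \<in> R" "a = 1 \<or> a = 3"
    using assms Z4_cases by (cases x) (auto simp: A_def E_def)
  have "\<exists>s. {s \<in> S. x + s \<in> K} = {s}"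
    using x(3)
  proof
    assume a: "a = 1"
    obtain i where i: "i < M" "2 * (r - t i) = 0" using t_reduce x by blast
    have "j = i" if "j < M" "2 * (r - t j) = 0" for j
      using t_distinct[of j i] that i by (simp add: algebra_simps)
    then have "{s \<in> S. x + s \<in> K} = {(- 1, - t i)}"
      using i x a t_R diff_R by (auto simp: S_def K_def)
    then show ?thesis by blast
  next
    assume a: "a = 3"
    \<comment> \<open>Here \<open>r + t i\<close> has to vanish modulo 2, so \<open>t i\<close>
      represents the residue of \<open>- r\<close>.\<close>
    obtain i where i: "i < M" "2 * (- r - t i) = 0" using t_reduce x minus_R by blast
    have "j = i" if "j < M" "2 * (- r - t j) = 0" for j
      using t_distinct[of j i] that i by (simp add: algebra_simps)
    moreover have "x + (1, t j) \<in> K \<longleftrightarrow> 2 * (- r - t j) = 0" if "j < M" for j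
    proof -
      have "2 * (- r - t j) = - (2 * (r + t j))" by (simp add: algebra_simps)
      then have "2 * (- r - t j) = 0 \<longleftrightarrow> 2 * (r + t j) = 0" by (simp only: neg_equal_0_iff_equal)
      then show ?thesis using x a t_R add_R that by (simp add: K_def)
    qed
    moreover have "x + (- 1, - t j) \<notin> K" for j using x a by (simp add: K_def)
    ultimately have "{s \<in> S. x + s \<in> K} = {(1, t i)}"
      using i by (auto simp: S_def)
    then show ?thesis by blast
  qed
  then show ?thesis by auto
qed

sublocale cayley_levels A S E K
proof
  show "x - y \<in> A" if "x \<in> A" "y \<in> A" for x y
    using that diff_R by (auto simp: A_def)
  show "2 \<le> card S" using card_S M by simp
  show "x + s \<in> E \<longleftrightarrow> x \<notin> E" if "x \<in> A" "s \<in> S" for x s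
  proof -
    obtain a r where x: "x = (a, r)" "r \<in> R" using \<open>x \<in> A\<close> by (auto simp: A_def)
    show ?thesis
      using \<open>s \<in> S\<close> x Z4_cases[of a] t_R add_R diff_R by (auto simp: S_def E_def)
  qed
  have "card {0 :: 'a} < card {r \<in> R. 2 * r = 0}" using card_R2 M by simp
  then have "\<not> {r \<in> R. 2 * r = 0} \<subseteq> {0}" by (metis card_mono finite.emptyI finite.insertI not_le)
  then show "\<exists>x\<in>A \<inter> K. x \<noteq> 0" by (auto simp: A_def K_def zero_prod_def)
  show "0 \<in> A" "K \<subseteq> E" "0 \<in> K" "S \<inter> E = {}"
    using zero_R by (auto simp: A_def K_def E_def S_def zero_prod_def)
qed (use finite_A S_A S_minus sum_in_K card_sum_eq_2 card_to_K in blast)+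

end

section \<open>The Galois ring \<open>\<int>\<^sub>4[X]/(h)\<close>\<close>

lemma reduce2_simps [simp]:
  "reduce2 0 = 0" "reduce2 1 = 1" "reduce2 2 = 0" "reduce2 3 = 1"
  by (simp_all add: reduce2_def bit0.Rep_0 bit0.Rep_1 bit0.Rep_numeral)

lemma Z4_numerals [simp]: "(4 :: 4) = 0" "(5 :: 4) = 1" "(6 :: 4) = 2" "(9 :: 4) = 1"
  by simp_all

lemma reduce2_add: "reduce2 (a + b) = reduce2 a + reduce2 b"
  using Z4_cases[of a] Z4_cases[of b] by (elim insertE emptyE) simp_all

lemma reduce2_mult: "reduce2 (a * b) = reduce2 a * reduce2 b"
  using Z4_cases[of a] Z4_cases[of b] by (elim insertE emptyE) simp_all

lemma reduce2_sum: "reduce2 (sum f X) = (\<Sum>x\<in>X. reduce2 (f x))"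
  by (induction X rule: infinite_finite_induct) (auto simp: reduce2_add)

lemma reduce2_eq_0_iff: "reduce2 a = 0 \<longleftrightarrow> 2 * a = 0"
  using Z4_cases[of a] by (elim insertE emptyE) simp_all

abbreviation red :: "4 poly \<Rightarrow> bit poly" where
  "red \<equiv> map_poly reduce2"

lemma coeff_red [simp]: "coeff (red p) i = reduce2 (coeff p i)"
  by (simp add: coeff_map_poly)

lemma red_add: "red (p + q) = red p + red q"
  by (rule poly_eqI) (simp add: reduce2_add)

lemma red_mult: "red (p * q) = red p * red q"
  by (rule poly_eqI) (simp add: coeff_mult reduce2_sum reduce2_mult)

lemma red_0 [simp]: "red 0 = 0"
  by (rule poly_eqI) simp

lemma red_minus: "red (- p) = - red p"
proof -
  have "red p + red (- p) = 0" using red_add[of p "- p"] by simp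
  then show ?thesis by (rule minus_unique[symmetric])
qed

lemma red_diff: "red (p - q) = red p - red q"
  using red_add[of p "- q"] by (simp add: red_minus)

lemma red_monom_1 [simp]: "red (monom 1 k) = monom 1 k"
  by (rule poly_eqI) simp

lemma coeff_2_mult: "coeff (2 * p) i = 2 * coeff p i" for p :: "'a::comm_ring_1 poly"
  by (simp only: mult_2 coeff_add)

lemma red_eq_0_iff: "red p = 0 \<longleftrightarrow> 2 * p = 0"
  by (simp add: poly_eq_iff reduce2_eq_0_iff coeff_2_mult)

lemma four_poly: "(4 :: 4 poly) = 0"
  by (rule poly_eqI) (simp add: numeral_poly coeff_pCons split: nat.split)

lemma red_surj: "\<exists>p. red p = q"
proof
  show "red (map_poly (\<lambda>b. if b = 0 then 0 else 1) q) = q"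
    by (rule poly_eqI) (simp add: coeff_map_poly)
qed

lemma red_eq_0_imp_double:
  assumes "red p = 0"
  shows "\<exists>q. p = 2 * q"
proof
  have double: "a = 2 * (if a = 0 then 0 else 1)" if "reduce2 a = 0" for a
    using that Z4_cases[of a] by (elim insertE emptyE) simp_all
  show "p = 2 * map_poly (\<lambda>a. if a = 0 then 0 else 1) p"
  proof (rule poly_eqI)
    fix i
    have "reduce2 (coeff p i) = 0" using assms coeff_red[of p i] by simp
    from double[OF this] show "coeff p i = coeff (2 * map_poly (\<lambda>a. if a = 0 then 0 else 1) p) i"
      by (subst coeff_2_mult, subst coeff_map_poly) simp_all
  qed
qed

text \<open>A polynomial is identified with the list of its first \<open>m\<close> coefficients. The
  set \<open>B\<close> will be all of \<open>bit\<close>, all of \<open>4\<close>, and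
  \<open>{0, 2}\<close>.\<close>

lemma card_polys_bounded:
  fixes B :: "'a::zero set"
  assumes "finite B"
  shows "card {p. (\<forall>i<m. coeff p i \<in> B) \<and> (\<forall>i\<ge>m. coeff p i = 0)} = card B ^ m" (is "card ?P = _")
    and "finite {p. (\<forall>i<m. coeff p i \<in> B) \<and> (\<forall>i\<ge>m. coeff p i = 0)}"
proof -
  let ?L = "{xs. set xs \<subseteq> B \<and> length xs = m}"
  have "bij_betw (\<lambda>p. map (coeff p) [0..<m]) ?P ?L"
  proof (rule bij_betw_byWitness[where f' = Poly])
    show "\<forall>p\<in>?P. Poly (map (coeff p) [0..<m]) = p"
    proof
      fix p assume "p \<in> ?P"
      then show "Poly (map (coeff p) [0..<m]) = p"
        by (intro poly_eqI) (simp add: nth_default_def not_less)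
    qed
    show "\<forall>xs\<in>?L. map (coeff (Poly xs)) [0..<m] = xs"
    proof
      fix xs assume "xs \<in> ?L"
      then show "map (coeff (Poly xs)) [0..<m] = xs"
        by (intro nth_equalityI) (simp_all add: nth_default_def)
    qed
    show "(\<lambda>p. map (coeff p) [0..<m]) ` ?P \<subseteq> ?L" by auto
    show "Poly ` ?L \<subseteq> ?P"
    proof (rule image_subsetI)
      fix xs assume "xs \<in> ?L"
      then show "Poly xs \<in> ?P" by (auto simp: nth_default_def subset_iff)
    qed
  qed
  then have "card ?P = card ?L" "finite ?P \<longleftrightarrow> finite ?L"
    by (rule bij_betw_same_card, rule bij_betw_finite)
  then show "card ?P = card B ^ m" "finite ?P"
    using assms by (simp_all only: card_lists_length_eq finite_lists_length_eq)
qed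

lemma diff_dvd_power_diff: "x - y dvd x ^ k - y ^ k" for x :: "'a::comm_ring_1"
  by (simp add: power_diff_sumr2)

section \<open>Congruence modulo 2 and \<open>h\<close>\<close>

locale preparata_poly =
  fixes m :: nat and h2 :: "bit poly" and h :: "4 poly"
  assumes m_odd: "odd m" and m_pos: "m \<ge> 3"
    and primitive: "primitive_irreducible h2"
    and degree_h2: "degree h2 = m" and monic_h: "lead_coeff h = 1" and degree_h: "degree h = m"
    and red_h: "red h = h2" and h_dvd: "h dvd monom 1 (2 ^ m - 1) - 1"
begin

definition n :: nat where "n = 2 ^ m - 1"

text \<open>Index 0 is the check coordinate and carries the Teichmueller element 0; index
  \<open>t + 1\<close> carries the class of X^t.\<close>

definition col :: "nat \<Rightarrow> 4 poly" where
  "col i = (if i = 0 then 0 else monom 1 (i - 1))"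

text \<open>\<open>dvd2 p\<close> expresses that \<open>p\<close> is zero in the residue field \<open>\<int>\<^sub>4[X]/(2, h)\<close>: doubling annihilates exactly
  the multiples of 2.\<close>

definition dvd2 :: "4 poly \<Rightarrow> bool" where
  "dvd2 p \<longleftrightarrow> h dvd 2 * p"

lemma n_pos: "n > 0" and pow_eq: "2 ^ m = Suc n"
proof -
  have "(2 :: nat) ^ m \<ge> 2 ^ 1" using m_pos by (intro power_increasing) auto
  then show "n > 0" "2 ^ m = Suc n" by (auto simp: n_def)
qed

text \<open>If \<open>2 * p = h * q\<close>, reduction gives \<open>h2 * red q = 0\<close>, so
  \<open>q\<close> is even and the common factor 2 can be removed up to even polynomials. Conversely
  the quotient is lifted coefficientwise.\<close>

lemma dvd2_iff_red: "dvd2 p \<longleftrightarrow> h2 dvd red p"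
proof
  assume "dvd2 p"
  then obtain q where q: "2 * p = h * q" by (auto simp: dvd2_def elim: dvdE)
  have "red (2 * p) = 0" by (simp add: red_eq_0_iff mult.assoc[symmetric] four_poly)
  then have "h2 * red q = 0" by (simp add: q red_mult red_h)
  then have "red q = 0" using degree_h2 m_pos by auto
  then obtain q' where "q = 2 * q'" using red_eq_0_imp_double by blast
  then have "2 * (p - h * q') = 0" using q by (simp add: algebra_simps)
  then have "red p = h2 * red q'" using red_eq_0_iff[of "p - h * q'"]
    by (simp add: red_diff red_mult red_h)
  then show "h2 dvd red p" by simp
next
  assume "h2 dvd red p"
  then obtain b where b: "red p = h2 * b" by (elim dvdE)
  obtain q where "red q = b" using red_surj by blast
  then have "red (p - h * q) = 0" using b by (simp add: red_diff red_mult red_h)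
  then have "2 * p = h * (2 * q)" by (simp add: red_eq_0_iff algebra_simps)
  then show "dvd2 p" by (simp add: dvd2_def)
qed

lemma dvd_imp_dvd2: "h dvd p \<Longrightarrow> dvd2 p"
  by (simp add: dvd2_def)

lemma dvd2_double: "dvd2 (2 * p)"
  by (simp add: dvd2_def mult.assoc[symmetric] four_poly)

lemma dvd2_add: "dvd2 p \<Longrightarrow> dvd2 q \<Longrightarrow> dvd2 (p + q)"
  by (simp add: dvd2_def distrib_left)

lemma dvd2_diff: "dvd2 p \<Longrightarrow> dvd2 q \<Longrightarrow> dvd2 (p - q)"
  by (simp add: dvd2_def right_diff_distrib)

lemma dvd2_mult: "dvd2 p \<Longrightarrow> dvd2 (q * p)"
  by (simp add: dvd2_def mult.left_commute)

lemma irreducible_h2: "irreducible h2"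
  using primitive by (simp add: primitive_irreducible_def)

lemma dvd2_prime: "dvd2 (p * q) \<Longrightarrow> dvd2 p \<or> dvd2 q"
  using field_poly_irreducible_imp_prime[OF irreducible_h2]
  by (auto simp: dvd2_iff_red red_mult dest: prime_elem_dvd_multD)

lemma not_dvd2_1: "\<not> dvd2 1"
proof -
  have "red 1 = 1" by (rule poly_eqI) (simp add: one_poly_eq_simps)
  then show ?thesis using irreducible_h2 by (simp add: dvd2_iff_red irreducible_not_unit)
qed

lemma dvd2_power: "dvd2 (p ^ k) \<Longrightarrow> dvd2 p"
  by (induction k) (use not_dvd2_1 dvd2_prime in auto)

text \<open>With \<open>p = q + h * w + 2 * a\<close>, every term of \<open>p ^ 2 - q ^ 2\<close>
  without the factor \<open>h\<close> carries a factor 4. This lifts congruences modulo 2 to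
  congruences modulo 4.\<close>

lemma square_cong:
  assumes "dvd2 (p - q)"
  shows "h dvd p ^ 2 - q ^ 2"
proof -
  obtain b where b: "red (p - q) = h2 * b" using assms dvd2_iff_red by (auto)
  obtain w where "red w = b" using red_surj by blast
  then have "red (p - q - h * w) = 0" using b by (simp add: red_diff red_mult red_h)
  then obtain a where "p - q - h * w = 2 * a" using red_eq_0_imp_double by blast
  then have p: "p = q + h * w + 2 * a" by (simp add: algebra_simps)
  have "p ^ 2 - q ^ 2 = h * (w * (2 * q + h * w + 4 * a)) + 4 * (a * q + a ^ 2)"
    unfolding p by (simp add: power2_eq_square algebra_simps)
  then show ?thesis by (simp add: four_poly)
qed

section \<open>Teichmueller elements and their square roots\<close>

lemma monom_cycle: "h dvd monom 1 (a + n * k) - monom 1 a"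
proof -
  have "monom 1 n - 1 dvd monom 1 n ^ k - (1 :: 4 poly) ^ k"
    by (rule diff_dvd_power_diff)
  then have "monom 1 n - 1 dvd monom 1 n ^ k - (1 :: 4 poly)" by (simp only: power_one)
  with h_dvd[folded n_def] have "h dvd monom 1 n ^ k - 1" by (rule dvd_trans)
  then have "h dvd monom 1 a * (monom 1 n ^ k - 1)" by (rule dvd_mult)
  then show ?thesis by (simp add: monom_power mult_monom algebra_simps)
qed

text \<open>Exponents of X count modulo \<open>n\<close>, and \<open>2 ^ (m - 1)\<close> is the
  inverse of 2 modulo \<open>n = 2 ^ m - 1\<close>.\<close>

lemma col_sqrt: "\<exists>a. h dvd a ^ 2 - col i"
proof (cases "i = 0")
  case True
  then show ?thesis by (intro exI[of _ 0]) (simp add: col_def)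
next
  case False
  have "2 * 2 ^ (m - 1) = (2 :: nat) ^ m" using m_pos by (cases m) auto
  then have two: "2 * 2 ^ (m - 1) = Suc n" using pow_eq by (simp only:)
  have "j * 2 ^ (m - 1) * 2 = j + n * j" for j
  proof -
    have "j * 2 ^ (m - 1) * 2 = j * (2 * 2 ^ (m - 1))" by (simp only: mult.assoc mult.commute)
    then show ?thesis by (simp only: two) simp
  qed
  then show ?thesis using False monom_cycle[of "i - 1" "i - 1"]
    by (intro exI[of _ "monom 1 ((i - 1) * 2 ^ (m - 1))"]) (simp add: col_def monom_power)
qed

text \<open>Primitivity makes each nonzero residue a power of X, with exponent reducible modulo
  \<open>n\<close>; the zero residue is \<open>col 0\<close>.\<close>

lemma col_reduce: "\<exists>i<2 ^ m. dvd2 (p - col i)"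
proof (cases "dvd2 p")
  case True
  then show ?thesis by (intro exI[of _ 0]) (simp add: col_def)
next
  case False
  then obtain k where k: "h2 dvd red p - monom 1 k"
    using primitive by (auto simp: primitive_irreducible_def dvd2_iff_red)
  then have "dvd2 (p - monom 1 k)" by (simp add: dvd2_iff_red red_diff)
  moreover have "dvd2 (monom 1 k - monom 1 (k mod n))"
    using monom_cycle[of "k mod n" "k div n"] by (intro dvd_imp_dvd2) simp
  ultimately have "dvd2 (p - monom 1 (k mod n))" using dvd2_add by fastforce
  then show ?thesis
    using n_pos pow_eq by (intro exI[of _ "Suc (k mod n)"]) (simp add: col_def)
qed

text \<open>By \<open>col_reduce\<close> the \<open>2 ^ m\<close> columns meet all
  \<open>2 ^ m\<close> residues, so no residue is met twice.\<close>

lemma col_distinct: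
  assumes "dvd2 (col i - col j)" "i < 2 ^ m" "j < 2 ^ m"
  shows "i = j"
proof -
  let ?F = "{r :: bit poly. (\<forall>i<m. coeff r i \<in> UNIV) \<and> (\<forall>i\<ge>m. coeff r i = 0)}"
  let ?g = "\<lambda>i. red (col i) mod h2"
  have UNIV_bit: "(UNIV :: bit set) = {0, 1}" using bit_not_zero_iff by blast
  have "card ?F = card (UNIV :: bit set) ^ m" by (rule card_polys_bounded) (simp add: UNIV_bit)
  then have card_F: "card ?F = 2 ^ m" by (simp add: UNIV_bit numeral_2_eq_2)
  have "?F \<subseteq> ?g ` {..<2 ^ m}"
  proof
    fix r assume r: "r \<in> ?F"
    obtain p where p: "red p = r" using red_surj by blast
    obtain i where i: "i < 2 ^ m" "dvd2 (p - col i)" using col_reduce by blast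
    have "r = 0 \<or> degree r < m" using r by (auto intro: degree_lessI)
    then have "r mod h2 = r" using degree_h2 by (auto simp: mod_poly_less)
    moreover have "r mod h2 = ?g i"
      using i p by (simp add: dvd2_iff_red red_diff mod_eq_dvd_iff)
    ultimately show "r \<in> ?g ` {..<2 ^ m}" using i by auto
  qed
  then have "card ?F \<le> card (?g ` {..<2 ^ m})" by (intro card_mono) auto
  then have "card (?g ` {..<2 ^ m}) = card {..<(2 :: nat) ^ m}"
    using card_F card_image_le[of "{..<2 ^ m}" ?g] by simp
  then have "inj_on ?g {..<2 ^ m}" by (intro eq_card_imp_inj_on) auto
  then show ?thesis
    using assms by (auto simp: dvd2_iff_red red_diff mod_eq_dvd_iff dest: inj_onD)
qed

lemma col_distinct_sqrt:
  assumes "h dvd a ^ 2 - col i" "h dvd b ^ 2 - col j" "dvd2 (a - b)" "i < 2 ^ m" "j < 2 ^ m"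
  shows "i = j"
proof (rule col_distinct)
  have "h dvd (a ^ 2 - b ^ 2) - (a ^ 2 - col i) + (b ^ 2 - col j)"
    by (rule dvd_add[OF dvd_diff[OF square_cong[OF assms(3)] assms(1)] assms(2)])
  then show "dvd2 (col i - col j)" by (intro dvd_imp_dvd2) simp
qed (use assms in auto)

lemma col_diff_unique:
  assumes "h dvd col i + col j - (col k + col l)"
    and lt: "i < 2 ^ m" "j < 2 ^ m" "k < 2 ^ m" "l < 2 ^ m"
  shows "i = k \<and> j = l \<or> i = l \<and> j = k"
proof -
  obtain a b c d where sq: "h dvd a ^ 2 - col i" "h dvd b ^ 2 - col j"
      "h dvd c ^ 2 - col k" "h dvd d ^ 2 - col l"
    using col_sqrt by metis
  have "h dvd (a ^ 2 - col i) + (b ^ 2 - col j) - ((c ^ 2 - col k) + (d ^ 2 - col l))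
      + (col i + col j - (col k + col l))"
    by (rule dvd_add[OF dvd_diff[OF dvd_add[OF sq(1,2)] dvd_add[OF sq(3,4)]] assms(1)])
  then have s: "h dvd a ^ 2 + b ^ 2 - (c ^ 2 + d ^ 2)" by (simp add: algebra_simps)
  let ?y = "a + b - (c + d)"
  \<comment> \<open>Up to an even polynomial, \<open>?y ^ 2\<close> is the sum of the four squares,
    so \<open>?y\<close> vanishes modulo 2.\<close>
  have y2: "?y ^ 2 = (a ^ 2 + b ^ 2 - (c ^ 2 + d ^ 2))
      + 2 * (c ^ 2 + d ^ 2 + a * b - a * c - a * d - b * c - b * d + c * d)"
    by (simp add: power2_eq_square algebra_simps)
  have "dvd2 (?y ^ 2)" unfolding y2 by (rule dvd2_add[OF dvd_imp_dvd2[OF s] dvd2_double])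
  then have y: "dvd2 ?y" by (rule dvd2_power)
  \<comment> \<open>Now \<open>(a + b) ^ 2\<close> and \<open>(c + d) ^ 2\<close> agree modulo 4;
    subtracting the known relation between squares leaves twice the products.\<close>
  have "h dvd ((a + b) ^ 2 - (c + d) ^ 2) - (a ^ 2 + b ^ 2 - (c ^ 2 + d ^ 2))"
    using square_cong[OF y] s by (rule dvd_diff)
  also have "((a + b) ^ 2 - (c + d) ^ 2) - (a ^ 2 + b ^ 2 - (c ^ 2 + d ^ 2)) = 2 * (a * b - c * d)"
    by (simp add: power2_eq_square algebra_simps)
  finally have "dvd2 (a * b - c * d)" by (simp add: dvd2_def)
  \<comment> \<open>Modulo 2 the pairs \<open>a\<close>, \<open>b\<close> and \<open>c\<close>,
    \<open>d\<close> have equal sum and product, so \<open>a\<close> is a root of the quadratic with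
    roots \<open>c\<close> and \<open>d\<close>.\<close>
  then have "dvd2 (a * ?y - (a * b - c * d))" using dvd2_mult[OF y] by (rule dvd2_diff[rotated])
  also have "a * ?y - (a * b - c * d) = (a - c) * (a - d)" by (simp add: algebra_simps)
  finally have "dvd2 ((a - c) * (a - d))" .
  then have "dvd2 (a - c) \<or> dvd2 (a - d)" using dvd2_prime by blast
  then have "i = k \<or> i = l" using col_distinct_sqrt sq lt by blast
  then show ?thesis
  proof
    assume "i = k"
    then have "dvd2 (col j - col l)" using assms(1) dvd_imp_dvd2 by auto
    then show ?thesis using col_distinct lt \<open>i = k\<close> by blast
  next
    assume "i = l"
    then have "dvd2 (col j - col k)" using assms(1) dvd_imp_dvd2 by (auto simp: algebra_simps)
    then show ?thesis using col_distinct lt \<open>i = l\<close> by blast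
  qed
qed

text \<open>Fermat's theorem in the residue field: \<open>u\<close> is congruent to a power of X,
  and X^n is 1.\<close>

lemma dvd2_order:
  assumes "\<not> dvd2 u"
  shows "dvd2 (u ^ n - 1)"
proof -
  obtain i where i: "dvd2 (u - col i)" using col_reduce by blast
  with assms have "i \<noteq> 0" by (auto simp: col_def split: if_splits)
  have "u - col i dvd u ^ n - col i ^ n" by (rule diff_dvd_power_diff)
  then have "dvd2 (u ^ n - col i ^ n)" using i dvd2_mult by (metis dvdE mult.commute)
  moreover have "col i ^ n = monom 1 (0 + n * (i - 1))"
    using \<open>i \<noteq> 0\<close> by (simp add: col_def monom_power mult.commute)
  then have "dvd2 (col i ^ n - 1)" using monom_cycle[of 0 "i - 1"] by (simp add: dvd_imp_dvd2)
  ultimately have "dvd2 ((u ^ n - col i ^ n) + (col i ^ n - 1))" by (rule dvd2_add)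
  then show ?thesis by simp
qed

text \<open>Odd powers of 2 are 2 modulo 3, so the order \<open>n\<close> of the multiplicative
  group of the residue field is prime to 3. This is where the oddness of \<open>m\<close>
  enters.\<close>

lemma n_mod_3: "\<exists>k. n = 3 * k + 1"
proof -
  obtain j where j: "m = 2 * j + 1" using m_odd by (elim oddE)
  have "\<exists>k. (2 :: nat) ^ (2 * j + 1) = 3 * k + 2"
  proof (induction j)
    case (Suc j)
    then obtain k where "(2 :: nat) ^ (2 * j + 1) = 3 * k + 2" by blast
    then have "(2 :: nat) ^ (2 * Suc j + 1) = 3 * (4 * k + 2) + 2" by simp
    then show ?case by blast
  qed auto
  then show ?thesis using pow_eq j by auto
qed

text \<open>For odd \<open>m\<close> the field with \<open>2\<^sup>m\<close> elements has no primitive cube root of unity, so the form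
  \<open>u\<^sup>2 + u v + v\<^sup>2\<close> is anisotropic.\<close>

lemma anisotropic:
  assumes uv: "dvd2 (u ^ 2 + u * v + v ^ 2)"
  shows "dvd2 u"
proof (rule ccontr)
  assume u: "\<not> dvd2 u"
  have v: "\<not> dvd2 v"
  proof
    assume "dvd2 v"
    then have "dvd2 ((u ^ 2 + u * v + v ^ 2) - (u + v) * v)" using uv by (intro dvd2_diff dvd2_mult)
    then have "dvd2 (u ^ 2)" by (simp add: power2_eq_square algebra_simps)
    then show False using u dvd2_power by blast
  qed
  obtain k where k: "n = 3 * k + 1" using n_mod_3 by blast
  have "u ^ 3 - v ^ 3 = (u - v) * (u ^ 2 + u * v + v ^ 2)"
    by (simp add: power2_eq_square power3_eq_cube algebra_simps)
  then have "dvd2 (u ^ 3 - v ^ 3)" using uv dvd2_mult by simp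
  moreover have "u ^ 3 - v ^ 3 dvd (u ^ 3) ^ k - (v ^ 3) ^ k" by (rule diff_dvd_power_diff)
  ultimately have "dvd2 ((u ^ 3) ^ k - (v ^ 3) ^ k)" using dvd2_mult by (metis dvdE mult.commute)
  \<comment> \<open>In the residue field u^(3k) = v^(3k), while u^(3k+1) = 1 = v^(3k+1); hence u =
    v.\<close>
  then have "dvd2 ((u ^ n - 1) - (v ^ n - 1) - v * ((u ^ 3) ^ k - (v ^ 3) ^ k))"
    by (rule dvd2_diff[OF dvd2_diff[OF dvd2_order[OF u] dvd2_order[OF v]] dvd2_mult])
  moreover have "w ^ n = w * (w ^ 3) ^ k" for w :: "4 poly" by (simp add: k power_mult)
  moreover have "(u * U - 1) - (v * V - 1) - v * (U - V) = U * (u - v)" for U V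
    by (simp add: algebra_simps)
  ultimately have "dvd2 ((u ^ 3) ^ k * (u - v))" by simp
  then have "dvd2 (u - v)" using dvd2_prime dvd2_power u by blast
  \<comment> \<open>For \<open>u\<close> congruent to \<open>v\<close> the form becomes
    \<open>3 * u ^ 2\<close>; subtracting it from \<open>4 * u ^ 2\<close> leaves
    \<open>u ^ 2\<close>.\<close>
  then have "dvd2 ((2 * (2 * u ^ 2)) - (u ^ 2 + u * v + v ^ 2) - (2 * u + v) * (u - v))"
    by (rule dvd2_diff[OF dvd2_diff[OF dvd2_double uv] dvd2_mult])
  then have "dvd2 (u ^ 2)" by (simp add: power2_eq_square algebra_simps)
  then show False using u dvd2_power by blast
qed

lemma col_sum_eq:
  assumes sum: "h dvd col i + col j + col k + col l"
    and lt: "i < 2 ^ m" "j < 2 ^ m" "k < 2 ^ m" "l < 2 ^ m"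
  shows "i = j"
proof -
  obtain a b c d where sq: "h dvd a ^ 2 - col i" "h dvd b ^ 2 - col j"
      "h dvd c ^ 2 - col k" "h dvd d ^ 2 - col l"
    using col_sqrt by metis
  have "h dvd (a ^ 2 - col i) + (b ^ 2 - col j) + (c ^ 2 - col k) + (d ^ 2 - col l)
      + (col i + col j + col k + col l)"
    by (rule dvd_add[OF dvd_add[OF dvd_add[OF dvd_add[OF sq(1,2)] sq(3)] sq(4)] sum])
  then have s: "h dvd a ^ 2 + b ^ 2 + c ^ 2 + d ^ 2" by (simp add: algebra_simps)
  let ?y = "a + b + c + d"
  let ?e = "a * b + a * c + b * c + d * (a + b + c)"
  have y2: "?y ^ 2 = (a ^ 2 + b ^ 2 + c ^ 2 + d ^ 2) + 2 * ?e"
    by (simp add: power2_eq_square algebra_simps)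
  have "dvd2 (?y ^ 2)" unfolding y2 by (rule dvd2_add[OF dvd_imp_dvd2[OF s] dvd2_double])
  then have y: "dvd2 ?y" by (rule dvd2_power)
  \<comment> \<open>Since \<open>?y\<close> vanishes modulo 2, its square vanishes modulo 4, and so
    does twice the second elementary symmetric function \<open>?e\<close>.\<close>
  then have "h dvd ?y ^ 2" using square_cong[of ?y 0] by simp
  then have "h dvd ?y ^ 2 - (a ^ 2 + b ^ 2 + c ^ 2 + d ^ 2)" using s by (rule dvd_diff)
  then have e: "dvd2 ?e" unfolding y2 dvd2_def by simp
  \<comment> \<open>The multiple of \<open>?y\<close> eliminates \<open>d\<close>; the even term
    completes the result to the form in \<open>a + b\<close> and \<open>a + c\<close>.\<close>
  have "dvd2 (?e + (a + b + c) * ?y + 2 * (a ^ 2 - d * (a + b + c) - b * c))"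
    by (rule dvd2_add[OF dvd2_add[OF e dvd2_mult[OF y]] dvd2_double])
  also have "?e + (a + b + c) * ?y + 2 * (a ^ 2 - d * (a + b + c) - b * c)
      = (a + b) ^ 2 + (a + b) * (a + c) + (a + c) ^ 2"
    by (simp add: power2_eq_square algebra_simps)
  finally have "dvd2 (a + b)" by (rule anisotropic)
  then have "dvd2 ((a + b) - 2 * b)" by (intro dvd2_diff dvd2_double)
  then have "dvd2 (a - b)" by (simp add: algebra_simps)
  then show ?thesis using col_distinct_sqrt sq lt by blast
qed

section \<open>Canonical remainders modulo \<open>h\<close>\<close>

definition rem :: "4 poly \<Rightarrow> 4 poly" where
  "rem p = snd (pseudo_divmod p h)"

definition R :: "4 poly set" where
  "R = {r. \<forall>i\<ge>m. coeff r i = 0}"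

text \<open>As \<open>h\<close> is monic, the leading coefficient of a nonzero multiple survives
  despite the zero divisors of the coefficient ring.\<close>

lemma h_dvd_R_imp_0:
  assumes "h dvd p" "p \<in> R"
  shows "p = 0"
proof (rule ccontr)
  assume "p \<noteq> 0"
  obtain q where q: "p = h * q" using assms by (elim dvdE)
  then have "q \<noteq> 0" using \<open>p \<noteq> 0\<close> by auto
  then have "coeff p (degree h + degree q) \<noteq> 0"
    using monic_h by (simp add: q coeff_mult_degree_sum)
  then show False using assms degree_h by (simp add: R_def)
qed

lemma h_dvd_diff_rem: "h dvd p - rem p" and rem_R: "rem p \<in> R"
proof -
  obtain q where q: "pseudo_divmod p h = (q, rem p)" by (metis rem_def prod.collapse)
  have "h \<noteq> 0" using degree_h m_pos by auto
  \<comment> \<open>The scaling factor of pseudo-division is a power of the leading coefficient,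
    here 1, so \<open>rem p\<close> is an ordinary remainder.\<close>
  from pseudo_divmod[OF this q] have "p = h * q + rem p" "rem p = 0 \<or> degree (rem p) < m"
    using monic_h degree_h by auto
  then have "p - rem p = h * q" by (simp add: algebra_simps)
  then show "h dvd p - rem p" by simp
  show "rem p \<in> R" using \<open>rem p = 0 \<or> degree (rem p) < m\<close> by (auto simp: R_def intro: coeff_eq_0)
qed

lemma diff_R: "x \<in> R \<Longrightarrow> y \<in> R \<Longrightarrow> x - y \<in> R" and add_R: "x \<in> R \<Longrightarrow> y \<in> R \<Longrightarrow> x + y \<in> R"
  by (auto simp: R_def)

lemma rem_unique: "r \<in> R \<Longrightarrow> h dvd p - r \<Longrightarrow> rem p = r"
  using h_dvd_R_imp_0[of "rem p - r"] dvd_diff[of h "p - r" "p - rem p"] h_dvd_diff_rem rem_R diff_R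
  by auto

lemma rem_id: "r \<in> R \<Longrightarrow> rem r = r"
  by (rule rem_unique) auto

lemma rem_add: "rem (p + q) = rem p + rem q"
proof (rule rem_unique)
  have "h dvd (p - rem p) + (q - rem q)" using h_dvd_diff_rem by (intro dvd_add)
  then show "h dvd p + q - (rem p + rem q)" by (simp add: algebra_simps)
qed (simp add: add_R rem_R)

lemma rem_diff: "rem (p - q) = rem p - rem q"
  using rem_add[of "p - q" q] by (simp add: algebra_simps)

lemma rem_minus: "rem (- p) = - rem p"
  using rem_diff[of 0 p] rem_id[of 0] by (simp add: R_def)

lemma rem_eq_0_iff: "rem p = 0 \<longleftrightarrow> h dvd p"
  using h_dvd_diff_rem[of p] rem_unique[of 0 p] by (auto simp: R_def)

text \<open>Translates \<open>dvd2\<close> into the form of congruence modulo 2 used in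
  \<open>teichmuller_columns\<close>.\<close>

lemma double_rem: "2 * rem p = 0 \<longleftrightarrow> dvd2 p"
  using rem_eq_0_iff[of "2 * p"] by (simp only: mult_2 rem_add dvd2_def)

lemma card_R: "card R = (2 ^ m) ^ 2" and finite_R: "finite R"
proof -
  have "R = {p. (\<forall>i<m. coeff p i \<in> UNIV) \<and> (\<forall>i\<ge>m. coeff p i = 0)}" by (simp add: R_def)
  then have "card R = 4 ^ m" "finite R"
    using card_polys_bounded[of "UNIV :: 4 set" m] by auto
  then show "card R = (2 ^ m) ^ 2" "finite R" by (auto simp: power2_eq_square simp flip: power_mult_distrib)
qed

lemma card_R_double_0: "card {r \<in> R. 2 * r = 0} = 2 ^ m"
proof -
  have "2 * a = 0 \<longleftrightarrow> a \<in> {0, 2}" for a :: 4 using Z4_cases[of a] by auto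
  then have "{r \<in> R. 2 * r = 0} = {p. (\<forall>i<m. coeff p i \<in> {0, 2}) \<and> (\<forall>i\<ge>m. coeff p i = 0)}"
    by (auto simp: R_def poly_eq_iff coeff_2_mult) (metis not_le)
  then show ?thesis using card_polys_bounded(1)[of "{0, 2 :: 4}" m] by (simp add: numeral_2_eq_2)
qed

end

section \<open>The Preparata coset graph\<close>

context preparata_poly
begin

section \<open>The syndrome map of the extended code\<close>

definition syndrome :: "4 vec \<Rightarrow> 4 \<times> 4 poly" where
  "syndrome x = (\<Sum>i<2 ^ m. x $ i, rem (\<Sum>i<2 ^ m. Polynomial.smult (x $ i) (col i)))"

lemma syndrome_diff:
  assumes "x \<in> carrier_vec (2 ^ m)" "y \<in> carrier_vec (2 ^ m)"
  shows "syndrome (x - y) = syndrome x - syndrome y"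
proof -
  have eq: "(x - y) $ i = x $ i - y $ i" if "i < 2 ^ m" for i using assms that by simp
  have "(\<Sum>i<2 ^ m. (x - y) $ i) = (\<Sum>i<2 ^ m. x $ i) - (\<Sum>i<2 ^ m. y $ i)"
    unfolding sum_subtractf[symmetric] by (intro sum.cong) (simp_all add: eq)
  moreover have "(\<Sum>i<2 ^ m. Polynomial.smult ((x - y) $ i) (col i))
      = (\<Sum>i<2 ^ m. Polynomial.smult (x $ i) (col i)) - (\<Sum>i<2 ^ m. Polynomial.smult (y $ i) (col i))"
    unfolding sum_subtractf[symmetric]
    by (intro sum.cong) (simp_all add: eq Polynomial.smult_diff_left)
  ultimately show ?thesis by (simp add: syndrome_def rem_diff)
qed

text \<open>The check coordinate meets \<open>col 0 = 0\<close>, so it enters the first component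
  only.\<close>

lemma syndrome_vCons:
  assumes "dim_vec c = n"
  shows "syndrome (vCons a c) = (a + (\<Sum>t<n. c $ t), rem (poly_of_vec4 c))"
proof -
  have "(\<Sum>i<2 ^ m. Polynomial.smult (vCons a c $ i) (col i)) = poly_of_vec4 c"
    using assms by (simp add: pow_eq sum.lessThan_Suc_shift poly_of_vec4_def col_def Polynomial.smult_monom
        del: sum.lessThan_Suc)
  moreover have "(\<Sum>i<2 ^ m. vCons a c $ i) = a + (\<Sum>t<n. c $ t)"
    by (simp add: pow_eq sum.lessThan_Suc_shift del: sum.lessThan_Suc)
  ultimately show ?thesis by (simp add: syndrome_def)
qed

lemma carrier_vec_pow_cases:
  assumes "x \<in> carrier_vec (2 ^ m)"
  obtains a c where "x = vCons a c" "dim_vec c = n"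
  using assms pow_eq by (cases x) auto

text \<open>Because \<open>h\<close> divides X^n - 1, working modulo X^n - 1 does not affect
  divisibility by \<open>h\<close>.\<close>

lemma cyclic_code_iff: "c \<in> cyclic_code n h \<longleftrightarrow> c \<in> carrier_vec n \<and> h dvd poly_of_vec4 c"
proof -
  have "(\<exists>a. monom 1 n - 1 dvd p - a * h) \<longleftrightarrow> h dvd p" for p
  proof
    assume "\<exists>a. monom 1 n - 1 dvd p - a * h"
    then obtain a where "monom 1 n - 1 dvd p - a * h" by blast
    then have "h dvd p - a * h" using h_dvd dvd_trans unfolding n_def by blast
    then have "h dvd (p - a * h) + a * h" by (rule dvd_add) simp
    then show "h dvd p" by simp
  next
    assume "h dvd p"
    then obtain a where "p = a * h" by (metis dvdE mult.commute)
    then show "\<exists>a. monom 1 n - 1 dvd p - a * h" by (intro exI[of _ a]) simp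
  qed
  then show ?thesis by (auto simp: cyclic_code_def)
qed

lemma preparata4_eq: "preparata4 m h = {x \<in> carrier_vec (2 ^ m). syndrome x = 0}"
proof (intro equalityI subsetI)
  fix x assume "x \<in> preparata4 m h"
  then obtain c where "c \<in> cyclic_code n h" "x = vCons (- (\<Sum>t<dim_vec c. c $ t)) c"
    by (auto simp: preparata4_def extend_code_def n_def)
  then show "x \<in> {x \<in> carrier_vec (2 ^ m). syndrome x = 0}"
    by (auto simp: cyclic_code_iff syndrome_vCons rem_eq_0_iff pow_eq zero_prod_def)
next
  fix x assume "x \<in> {x \<in> carrier_vec (2 ^ m). syndrome x = 0}"
  then have x: "x \<in> carrier_vec (2 ^ m)" "syndrome x = 0" by auto
  obtain a c where c: "x = vCons a c" "dim_vec c = n" using carrier_vec_pow_cases[OF x(1)] .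
  then have "a = - (\<Sum>t<dim_vec c. c $ t)" "c \<in> cyclic_code n h"
    using x carrier_vecI[OF c(2)]
    by (simp_all add: syndrome_vCons cyclic_code_iff rem_eq_0_iff zero_prod_def eq_neg_iff_add_eq_0)
  then show "x \<in> preparata4 m h"
    using c unfolding preparata4_def extend_code_def n_def[symmetric] by blast
qed

text \<open>The coefficients of \<open>r\<close> fit into the \<open>n\<close> cyclic coordinates
  because \<open>m \<le> n\<close>; the check coordinate then adjusts the first component
  freely.\<close>

lemma syndrome_range: "syndrome ` carrier_vec (2 ^ m) = UNIV \<times> R"
proof (intro equalityI subsetI)
  fix z :: "4 \<times> 4 poly" assume "z \<in> UNIV \<times> R"
  then obtain a r where z: "z = (a, r)" "r \<in> R" by auto
  define c where "c = vec n (coeff r)"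
  have "m < 2 ^ m" by (rule less_exp)
  then have "m \<le> n" by (simp add: pow_eq)
  have "poly_of_vec4 c = r"
  proof (rule poly_eqI)
    fix j
    have "coeff (poly_of_vec4 c) j = (\<Sum>t<n. if t = j then coeff r t else 0)"
      unfolding poly_of_vec4_def coeff_sum by (intro sum.cong) (auto simp: c_def)
    also have "\<dots> = coeff r j" using z \<open>m \<le> n\<close> by (simp add: R_def)
    finally show "coeff (poly_of_vec4 c) j = coeff r j" .
  qed
  then have "syndrome (vCons (a - (\<Sum>t<n. c $ t)) c) = z"
    using z by (subst syndrome_vCons) (simp_all add: c_def rem_id)
  moreover have "vCons (a - (\<Sum>t<n. c $ t)) c \<in> carrier_vec (2 ^ m)"
    by (simp add: pow_eq c_def)
  ultimately show "z \<in> syndrome ` carrier_vec (2 ^ m)" by blast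
qed (auto simp: syndrome_def rem_R)

lemma syndrome_single:
  assumes "i < 2 ^ m"
  shows "syndrome (vec (2 ^ m) (\<lambda>j. if j = i then a else 0)) = (a, rem (Polynomial.smult a (col i)))"
proof -
  have "(\<Sum>k<2 ^ m. Polynomial.smult (vec (2 ^ m) (\<lambda>j. if j = i then a else 0) $ k) (col k))
      = (\<Sum>k<2 ^ m. if k = i then Polynomial.smult a (col i) else 0)"
    by (intro sum.cong) auto
  moreover have "(\<Sum>k<2 ^ m. vec (2 ^ m) (\<lambda>j. if j = i then a else 0) $ k)
      = (\<Sum>k<2 ^ m. if k = i then a else 0)"
    by (intro sum.cong) auto
  ultimately show ?thesis using assms by (simp add: syndrome_def)
qed

lemma lee_eq_0_iff: "lee a = 0 \<longleftrightarrow> a = 0"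
  by (simp add: lee_def)

lemma lee_weight_1_vectors:
  "{v \<in> carrier_vec l. lee_weight v = 1}
    = (\<lambda>(i, a). vec l (\<lambda>j. if j = i then a else 0)) ` ({..<l} \<times> {1, - 1})" (is "?L = ?R")
proof (intro equalityI subsetI)
  fix v assume "v \<in> ?L"
  then have v: "dim_vec v = l" "(\<Sum>i<l. lee (v $ i)) = 1" by (auto simp: lee_weight_def)
  then obtain i where i: "i < l" "lee (v $ i) = 1" "\<And>j. j < l \<Longrightarrow> j \<noteq> i \<Longrightarrow> lee (v $ j) = 0"
    by (subst (asm) sum_eq_1_iff) auto
  have "v $ i \<in> {1, - 1}"
    using i(2) Z4_cases[of "v $ i"] by (auto simp: lee_def split: if_splits)
  moreover have "v = vec l (\<lambda>j. if j = i then v $ i else 0)"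
    using i(3) v by (intro eq_vecI) (auto simp: lee_eq_0_iff)
  ultimately show "v \<in> ?R" using i(1) by (intro image_eqI[where x = "(i, v $ i)"]) auto
next
  fix v assume "v \<in> ?R"
  then obtain i a where v: "v = vec l (\<lambda>j. if j = i then a else 0)" "i < l" "lee a = 1"
    by (auto simp: lee_def)
  then have "lee_weight v = (\<Sum>j<l. if j = i then 1 else 0)"
    unfolding lee_weight_def by (intro sum.cong) (auto simp: lee_def)
  then show "v \<in> ?L" using v by simp
qed

sublocale teichmuller_columns "2 ^ m" R "\<lambda>i. rem (col i)"
proof
  show "2 \<le> (2 :: nat) ^ m" using n_pos pow_eq by simp
  show "\<exists>i<2 ^ m. 2 * (r - rem (col i)) = 0" if "r \<in> R" for r
  proof -
    obtain i where i: "i < 2 ^ m" "dvd2 (r - col i)" using col_reduce by blast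
    have "2 * rem (r - col i) = 0" using i by (simp only: double_rem)
    then have "2 * (r - rem (col i)) = 0" by (simp only: rem_diff rem_id[OF that])
    with i show ?thesis by blast
  qed
  show "i = j" if "i < 2 ^ m" "j < 2 ^ m" "2 * (rem (col i) - rem (col j)) = 0" for i j
  proof (rule col_distinct)
    have "2 * rem (col i - col j) = 0" using that by (simp only: rem_diff)
    then show "dvd2 (col i - col j)" by (simp only: double_rem)
  qed (use that in auto)
  show "i = k \<and> j = l \<or> i = l \<and> j = k"
    if lt: "i < 2 ^ m" "j < 2 ^ m" "k < 2 ^ m" "l < 2 ^ m"
      and eq: "rem (col i) + rem (col j) = rem (col k) + rem (col l)" for i j k l
  proof (rule col_diff_unique)
    have "rem (col i + col j - (col k + col l)) = 0" using eq by (simp add: rem_diff rem_add)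
    then show "h dvd col i + col j - (col k + col l)" by (simp add: rem_eq_0_iff)
  qed (use lt in auto)
  show "i = j \<and> i = k \<and> i = l"
    if lt: "i < 2 ^ m" "j < 2 ^ m" "k < 2 ^ m" "l < 2 ^ m"
      and eq: "rem (col i) + rem (col j) + rem (col k) + rem (col l) = 0" for i j k l
  proof -
    have "rem (col i + col j + col k + col l) = 0" using eq by (simp add: rem_add)
    then have "h dvd col i + col j + col k + col l" by (simp add: rem_eq_0_iff)
    then show ?thesis
      \<comment> \<open>The sum is symmetric, so permuting the indices yields the remaining
        equalities.\<close>
      using col_sum_eq[of i j k l] col_sum_eq[of i k j l] col_sum_eq[of i l j k] lt
      by (auto simp: ac_simps)
  qed
qed (use finite_R card_R card_R_double_0 rem_R diff_R in \<open>auto simp: R_def\<close>)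

lemma Gamma_graph_properties:
  "distance_regular (Gamma_graph m h) \<and> card (pverts (Gamma_graph m h)) = (2 ^ (m + 1)) ^ 2 \<and>
    graph_diameter (Gamma_graph m h) = 4 \<and>
    (\<forall>v\<in>pverts (Gamma_graph m h). out_degree (with_proj (Gamma_graph m h)) v = 2 ^ (m + 1))"
proof -
  have A_eq: "A = syndrome ` carrier_vec (2 ^ m)"
    by (simp add: A_def syndrome_range)
  have S_eq: "S = syndrome ` {v \<in> carrier_vec (2 ^ m). lee_weight v = 1}"
    unfolding lee_weight_1_vectors image_image
    by (force simp: S_def syndrome_single rem_minus image_iff)
  obtain f where f: "inj_on f A" "pverts (Gamma_graph m h) = f ` A"
      "parcs (Gamma_graph m h) = {(f x, f y) | x y. x \<in> A \<and> y \<in> A \<and> x - y \<in> S}"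
    unfolding Gamma_graph_def
    by (rule coset_graph_syndrome[OF syndrome_diff preparata4_eq A_eq S_eq zero_not_S])
  have "card A = (2 ^ (m + 1)) ^ 2"
    using card_R by (simp add: A_def card_cartesian_product power2_eq_square)
  then have "card (pverts (Gamma_graph m h)) = (2 ^ (m + 1)) ^ 2"
    using f by (simp add: card_image)
  moreover have "card S = 2 ^ (m + 1)" using card_S by simp
  ultimately show ?thesis using cayley_graph_distance_regular[OF f] by simp
qed

end

theorem theorem22:
  fixes m n N :: nat and h2 :: "bit poly" and h :: "4 poly"
  assumes "m \<ge> 3" and "odd m"
    and "n = 2 ^ m - 1" and "N = 2 ^ (m + 1)"
    and "primitive_irreducible h2" and "degree h2 = m"
    and "lead_coeff h = 1" and "degree h = m"
    and "map_poly reduce2 h = h2"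
    and "h dvd monom 1 n - 1"
  shows "distance_regular (Gamma_graph m h) \<and>
         card (pverts (Gamma_graph m h)) = N ^ 2 \<and>
         graph_diameter (Gamma_graph m h) = 4 \<and>
         (\<forall>v \<in> pverts (Gamma_graph m h). out_degree (with_proj (Gamma_graph m h)) v = N)"
proof -
  interpret preparata_poly m h2 h
    using assms by unfold_locales simp_all
  show ?thesis using Gamma_graph_properties assms(4) by simp
qed


end
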